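(* Let $x$ and $y$ be distinct vertices of a bidirected graph $B$, and suppose that $x$ is edge-clean. Let $P_1,\dots,P_k$ be pairwise edge-disjoint $x$--$y$ paths in $B$, where $\vec e_i$ is the first oriented edge of $P_i$ for $i\in\{1,\dots,k\}$. Then precisely one of the following holds: (1) there is a set $S$ of $k$ edges of $B$ such that $B-S$ contains no $x$--$y$ path; (2) there are $k+1$ pairwise edge-disjoint $x$--$y$ paths $P_1',\dots,P_{k+1}'$ in $B$ such that the first oriented edge of $P_i'$ is $\vec e_i$ for $i\in\{1,\dots,k\}$.
   Context: A bidirected graph $B=(G,\sigma)$ consists of an undirected graph $G$ without loops (parallel edges allowed, but no two distinct edges have the same endvertices and the same signs at them) together with a signing $\sigma$ assigning to every pair $(u,e)$, $u$ an endvertex of edge $e$, a sign $\sigma(u,e)\in\{+,-\}$. An oriented edge is an edge with one endvertex chosen as startvertex and the other as endvertex. A walk is a sequence $v_0\vec e_1v_1\dots\vec e_\ell v_\ell$ where $\vec e_j$ is the edge $e_j$ oriented from $v_{j-1}$ to $v_j$ and $\sigma(v_i,e_i)\neq\sigma(v_i,e_{i+1})$ for $1\le i\le\ell-1$; it is nontrivial if $\ell\ge1$, and $\vec e_1$ is its first oriented edge. A trail is a walk whose edges $e_j$ are distinct; a path is a walk whose vertices are all distinct. An $x$--$y$ path is a nontrivial path with first vertex $x$ and last vertex $y$. Walks are edge-disjoint if they share no (underlying) edge. A vertex $x$ is edge-clean if there is no nontrivial trail in $B$ whose first and last vertex are both $x$. $B-S$ denotes deletion of the edge set $S$. *)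

theory Defs
  imports Main
begin

datatype sign = Pos | Neg

(* sgn_at B u e is the sign sigma(u,e); it is meaningful only for u in ends B e, and
   ends B e only for e in edges B. Edges have names of their own, since parallel edges
   are allowed. *)
record ('v, 'e) bigraph =
  verts :: "'v set"
  edges :: "'e set"
  ends :: "'e \<Rightarrow> 'v set"
  sgn_at :: "'v \<Rightarrow> 'e \<Rightarrow> sign"

(* No finiteness is assumed. *)
locale bidirected_graph =
  fixes B :: "('v, 'e) bigraph"
  assumes ends_edge:
      "e \<in> edges B \<Longrightarrow> \<exists>u\<in>verts B. \<exists>v\<in>verts B. u \<noteq> v \<and> ends B e = {u, v}"
    and same_ends_same_signs_eq:
      "\<lbrakk>e \<in> edges B; f \<in> edges B; ends B e = ends B f;
        \<forall>u\<in>ends B e. sgn_at B u e = sgn_at B u f\<rbrakk> \<Longrightarrow> e = f"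

definition delete_edges :: "('v, 'e) bigraph \<Rightarrow> 'e set \<Rightarrow> ('v, 'e) bigraph" where
  "delete_edges B S = B\<lparr>edges := edges B - S\<rparr>"

datatype ('v, 'e) oriented_edge =
  Oriented (startvertex: 'v) (edge_of: 'e) (endvertex: 'v)

definition oriented_edge_in :: "('v, 'e) bigraph \<Rightarrow> ('v, 'e) oriented_edge \<Rightarrow> bool" where
  "oriented_edge_in B a \<longleftrightarrow>
     edge_of a \<in> edges B \<and> ends B (edge_of a) = {startvertex a, endvertex a}"

(* Walk [v0, ..., vl] [a1, ..., al] stands for the sequence v0 a1 v1 ... al vl;
   as lists are indexed from 0, arcs W ! j is the oriented edge a(j+1). *)
datatype ('v, 'e) walk_seq =
  Walk (vertices: "'v list") (arcs: "('v, 'e) oriented_edge list")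

definition walk :: "('v, 'e) bigraph \<Rightarrow> ('v, 'e) walk_seq \<Rightarrow> bool" where
  "walk B W \<longleftrightarrow>
     length (vertices W) = length (arcs W) + 1 \<and>
     set (vertices W) \<subseteq> verts B \<and>
     (\<forall>j < length (arcs W).
        oriented_edge_in B (arcs W ! j) \<and>
        startvertex (arcs W ! j) = vertices W ! j \<and>
        endvertex (arcs W ! j) = vertices W ! Suc j) \<and>
     (\<forall>j. Suc j < length (arcs W) \<longrightarrow>
        sgn_at B (vertices W ! Suc j) (edge_of (arcs W ! j)) \<noteq>
        sgn_at B (vertices W ! Suc j) (edge_of (arcs W ! Suc j)))"

definition nontrivial :: "('v, 'e) walk_seq \<Rightarrow> bool" where
  "nontrivial W \<longleftrightarrow> length (arcs W) \<ge> 1"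

definition first_vertex :: "('v, 'e) walk_seq \<Rightarrow> 'v" where
  "first_vertex W = hd (vertices W)"

definition last_vertex :: "('v, 'e) walk_seq \<Rightarrow> 'v" where
  "last_vertex W = last (vertices W)"

definition first_oriented_edge :: "('v, 'e) walk_seq \<Rightarrow> ('v, 'e) oriented_edge" where
  "first_oriented_edge W = hd (arcs W)"

definition walk_edges :: "('v, 'e) walk_seq \<Rightarrow> 'e set" where
  "walk_edges W = edge_of ` set (arcs W)"

definition edge_disjoint :: "('v, 'e) walk_seq \<Rightarrow> ('v, 'e) walk_seq \<Rightarrow> bool" where
  "edge_disjoint W W' \<longleftrightarrow> walk_edges W \<inter> walk_edges W' = {}"

definition trail :: "('v, 'e) bigraph \<Rightarrow> ('v, 'e) walk_seq \<Rightarrow> bool" where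
  "trail B W \<longleftrightarrow> walk B W \<and> distinct (map edge_of (arcs W))"

definition path :: "('v, 'e) bigraph \<Rightarrow> ('v, 'e) walk_seq \<Rightarrow> bool" where
  "path B W \<longleftrightarrow> walk B W \<and> distinct (vertices W)"

definition path_between ::
    "('v, 'e) bigraph \<Rightarrow> 'v \<Rightarrow> 'v \<Rightarrow> ('v, 'e) walk_seq \<Rightarrow> bool" where
  "path_between B x y W \<longleftrightarrow>
     path B W \<and> nontrivial W \<and> first_vertex W = x \<and> last_vertex W = y"

definition edge_clean :: "('v, 'e) bigraph \<Rightarrow> 'v \<Rightarrow> bool" where
  "edge_clean B x \<longleftrightarrow>
     \<not> (\<exists>W. trail B W \<and> nontrivial W \<and> first_vertex W = x \<and> last_vertex W = x)"

definition edge_disjoint_paths ::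
    "('v, 'e) bigraph \<Rightarrow> 'v \<Rightarrow> 'v \<Rightarrow> nat \<Rightarrow> (nat \<Rightarrow> ('v, 'e) walk_seq) \<Rightarrow> bool" where
  "edge_disjoint_paths B x y n P \<longleftrightarrow>
     (\<forall>i\<in>{1..n}. path_between B x y (P i)) \<and>
     (\<forall>i\<in>{1..n}. \<forall>j\<in>{1..n}. i \<noteq> j \<longrightarrow> edge_disjoint (P i) (P j))"

end

theory Submission imports Defs begin

text \<open>Call an oriented edge reachable if it ends some trail starting at \<open>x\<close>, and two-way if both its
  orientations are reachable. Because \<open>x\<close> is edge-clean, every component of the two-way edges is
  entered by exactly one reachable arc that is not two-way, and all reachable arcs into a vertex
  without two-way edges carry the same sign there. Hence contracting these components (the analogues
  of Edmonds' blossoms) turns the part of \<open>B\<close> reachable from \<open>x\<close> into a digraph: \<open>x\<close>--\<open>y\<close> paths project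
  to directed walks, and disjoint directed walks lift back to edge-disjoint paths with the same first
  oriented edges. What remains is Menger's theorem for digraphs, in the augmenting form of Boehme,
  Goering and Harant, which keeps the old starting points.\<close>

section \<open>Trails in skew-symmetric graphs\<close>

text \<open>Cleanness enters only through the fact that no reachable arc ends at \<open>x\<close>.
  Hence no two-way edge is incident with \<open>x\<close>, and a trail from \<open>x\<close> to a
  two-way arc has a last arc that is not two-way: an entry of the component. The obstacle is that
  trails, unlike directed walks, cannot simply be concatenated, because the second may use edges of
  the first. What survives of concatenation is \<open>reach_dichotomy\<close>; it shows that both
  orientations of a two-way edge have the same entry. It follows that every vertex of a component
  can be reached from its entry with either sign, so a second entry could be traversed backwards and
  would be two-way itself. In the lifting direction a path must have distinct vertices, while
  contraction only controls classes. A walk that returns to a class is therefore shortened, which is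
  possible because arcs entering the same class are interchangeable. As \<open>B\<close> may be
  infinite, the augmentation is an induction on the total length of the given walks.\<close>

lemma disjoint_subsets: "A \<inter> B = {} \<Longrightarrow> A' \<subseteq> A \<Longrightarrow> B' \<subseteq> B \<Longrightarrow> A' \<inter> B' = {}"
  by blast

text \<open>An arc is an oriented edge and \<open>flip\<close> reverses it; \<open>sg a\<close> is the sign of \<open>a\<close> at its head
  \<open>tgt a\<close>, so tail and sign at the tail are \<open>tgt (flip a)\<close> and \<open>sg (flip a)\<close>.\<close>

locale signed_arcs =
  fixes flip :: "'a \<Rightarrow> 'a" and tgt :: "'a \<Rightarrow> 'v" and sg :: "'a \<Rightarrow> sign"
  assumes flip_flip [simp]: "flip (flip a) = a"
begin

definition follows :: "'a \<Rightarrow> 'a \<Rightarrow> bool" where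
  "follows a b \<longleftrightarrow> tgt a = tgt (flip b) \<and> sg a \<noteq> sg (flip b)"

text \<open>Encoding an edge as the set of its orientations lets this part work with arcs alone,
  without edge names.\<close>

definition ed :: "'a \<Rightarrow> 'a set" where
  "ed a = {a, flip a}"

definition trl :: "'a set set \<Rightarrow> 'a list \<Rightarrow> bool" where
  "trl E l \<longleftrightarrow> successively follows l \<and> ed ` set l \<subseteq> E \<and> distinct (map ed l)"

text \<open>Both ends are arcs of the trail, not vertices: the first fixes how the trail departs,
  the last with which sign it arrives.\<close>

definition reach :: "'a set set \<Rightarrow> 'a \<Rightarrow> 'a \<Rightarrow> bool" where
  "reach E a b \<longleftrightarrow> (\<exists>l. trl E l \<and> l \<noteq> [] \<and> hd l = a \<and> last l = b)"

lemma follows_flip: "follows (flip b) (flip a) \<longleftrightarrow> follows a b"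
  by (auto simp: follows_def)

lemma ed_flip [simp]: "ed (flip a) = ed a"
  by (auto simp: ed_def)

lemma ed_eq_iff: "ed a = ed b \<longleftrightarrow> a = b \<or> a = flip b"
  by (auto simp: ed_def doubleton_eq_iff)

lemma ed_in_image: "ed a \<in> ed ` S \<longleftrightarrow> a \<in> S \<or> flip a \<in> S"
proof
  assume "ed a \<in> ed ` S"
  then obtain b where "b \<in> S" "a = b \<or> a = flip b" by (auto simp: ed_eq_iff)
  then show "a \<in> S \<or> flip a \<in> S" by auto
next
  assume "a \<in> S \<or> flip a \<in> S"
  then show "ed a \<in> ed ` S" by (metis ed_flip image_eqI)
qed

lemma trl_append:
  "trl E (l @ m) \<longleftrightarrow> trl E l \<and> trl E m \<and> (l \<noteq> [] \<and> m \<noteq> [] \<longrightarrow> follows (last l) (hd m)) \<and>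
     ed ` set l \<inter> ed ` set m = {}"
  by (auto simp: trl_def successively_append_iff)

lemma trl_Nil [simp]: "trl E []"
  by (simp add: trl_def)

lemma trl_single [simp]: "trl E [a] \<longleftrightarrow> ed a \<in> E"
  by (simp add: trl_def)

lemma trl_Cons:
  "trl E (a # m) \<longleftrightarrow> ed a \<in> E \<and> trl E m \<and> (m \<noteq> [] \<longrightarrow> follows a (hd m)) \<and> ed a \<notin> ed ` set m"
  using trl_append[of E "[a]" m] by auto

lemma ed_image_flip [simp]: "ed ` set (map flip l) = ed ` set l"
  by (auto simp: image_iff)

lemma trl_rev:
  assumes "trl E l"
  shows "trl E (rev (map flip l))"
proof -
  have "successively follows (rev (map flip l))"
    using assms by (simp add: trl_def successively_map follows_flip)
  moreover have "map ed (rev (map flip l)) = rev (map ed l)"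
    by (simp add: rev_map)
  then have "distinct (map ed (rev (map flip l)))"
    using assms by (simp add: trl_def)
  ultimately show ?thesis using assms by (auto simp: trl_def)
qed

lemma trl_mono: "trl E l \<Longrightarrow> E \<subseteq> F \<Longrightarrow> trl F l"
  by (auto simp: trl_def)

lemma trl_restrict: "trl E l \<Longrightarrow> ed ` set l \<subseteq> F \<Longrightarrow> trl F l"
  by (auto simp: trl_def)

lemma reachI: "trl E l \<Longrightarrow> l \<noteq> [] \<Longrightarrow> hd l = a \<Longrightarrow> last l = b \<Longrightarrow> reach E a b"
  by (auto simp: reach_def)

lemma reach_mono: "reach E a b \<Longrightarrow> E \<subseteq> F \<Longrightarrow> reach F a b"
  unfolding reach_def using trl_mono by blast

lemma reach_flip:
  assumes "reach E a b"
  shows "reach E (flip b) (flip a)"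
proof -
  obtain l where l: "trl E l" "l \<noteq> []" "hd l = a" "last l = b"
    using assms by (auto simp: reach_def)
  show ?thesis
    by (rule reachI[OF trl_rev[OF l(1)]])
      (use l in \<open>auto simp: hd_rev last_rev last_map hd_map\<close>)
qed

lemma reach_prefix:
  assumes "trl E l" "l \<noteq> []" "hd l = a" "b \<in> set l"
  shows "reach E a b"
proof -
  obtain l1 l2 where l: "l = l1 @ b # l2" using assms(4) by (auto simp: in_set_conv_decomp)
  then have "trl E (l1 @ [b])" using assms(1) trl_append[of E "l1 @ [b]" l2] by simp
  then show ?thesis by (rule reachI) (use assms l in \<open>auto simp: hd_append\<close>)
qed

lemma reach_snoc:
  assumes "trl E l" "l \<noteq> []" "hd l = a" "follows (last l) b" "ed b \<notin> ed ` set l" "ed b \<in> E"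
  shows "reach E a b"
  by (rule reachI[of E "l @ [b]"]) (use assms in \<open>auto simp: trl_append\<close>)

text \<open>Induction along \<open>W\<close>: a trail from \<open>a\<close> to one arc of
  \<open>W\<close> extends to the next arc unless it has already used the edge of that arc. In that
  case \<open>a\<close> reaches the arc or its reverse, and \<open>turn\<close> repairs the second
  possibility. The hypothesis \<open>turn\<close> stands for the induction hypothesis of
  \<open>reach_dichotomy\<close>.\<close>

lemma reach_along:
  assumes "trl E W" "W \<noteq> []"
    and turn: "\<And>V V'. W = V @ V' \<Longrightarrow> V \<noteq> [] \<Longrightarrow> reach E a (flip (last V)) \<Longrightarrow> reach E a (last V)"
    and Y: "trl E Y" "Y \<noteq> []" "hd Y = a" "ed ` set Y \<inter> ed ` set W \<noteq> {}"
  shows "reach E a (last W)"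
  using assms(1,2) turn Y(4)
proof (induction W rule: rev_induct)
  case Nil
  then show ?case by simp
next
  case (snoc w V)
  have via: "reach E a w" if "trl E Z" "Z \<noteq> []" "hd Z = a" "ed w \<in> ed ` set Z" for Z
    using reach_prefix[OF that(1-3)] that(4) snoc.prems(3)[of "V @ [w]" "[]"]
    by (auto simp: ed_in_image)
  show ?case
  proof (cases "ed w \<in> ed ` set Y")
    case True
    then show ?thesis using via Y by simp
  next
    case False
    then have meets: "ed ` set Y \<inter> ed ` set V \<noteq> {}" using snoc.prems(4) by auto
    then have "V \<noteq> []" by auto
    have "trl E V" using snoc.prems(1) by (simp add: trl_append)
    have "reach E a (last V)"
      by (rule snoc.IH[OF \<open>trl E V\<close> \<open>V \<noteq> []\<close> _ meets])
        (metis snoc.prems(3) append.assoc)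
    then obtain Z where Z: "trl E Z" "Z \<noteq> []" "hd Z = a" "last Z = last V"
      by (auto simp: reach_def)
    show ?thesis
    proof (cases "ed w \<in> ed ` set Z")
      case True
      then show ?thesis using via Z by simp
    next
      case False
      have "follows (last Z) w" "ed w \<in> E"
        using snoc.prems(1) \<open>V \<noteq> []\<close> Z by (auto simp: trl_append)
      then show ?thesis using reach_snoc[OF Z(1-3) _ False] by simp
    qed
  qed
qed

text \<open>Induction on \<open>W\<close>. Assume that \<open>b\<close> does not reach \<open>flip a\<close>. Then \<open>W\<close> up to its last arc meets
  \<open>U\<close>, so by induction \<open>a\<close> reaches every arc of \<open>W\<close> from there on up to the last but one. If that trail
  does not extend by the last arc \<open>flip al\<close>, it has already used \<open>al\<close> and closed a loop \<open>L\<close> at the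
  head of \<open>al\<close>. Running the same argument outside of \<open>L\<close> and \<open>al\<close> shows that \<open>a\<close> reaches the arc of
  \<open>W\<close> before its first contact with \<open>L\<close>; going round \<open>L\<close> then leads to \<open>flip al\<close>.\<close>

lemma reach_dichotomy:
  assumes "trl E U" "U \<noteq> []" "hd U = a" "trl E W" "W \<noteq> []" "hd W = b" "last W = flip (last U)"
  shows "reach E b (flip a) \<or> reach E a (last W)"
  using assms
proof (induction "length W" arbitrary: E U W rule: less_induct)
  case less
  note U = less.prems(1-3) and W = less.prems(4-6)
  define al where "al = last U"
  have lastW: "last W = flip al" using less.prems(7) by (simp add: al_def)
  obtain W1 where W1: "W = W1 @ [flip al]"
    using lastW W(2) by (metis append_butlast_last_id)
  show ?case
  proof (rule ccontr)
    assume contra: "\<not> (reach E b (flip a) \<or> reach E a (last W))"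
    then have nb: "\<not> reach E b (flip a)" and na: "\<not> reach E a (flip al)"
      using lastW by auto
    \<comment> \<open>The induction hypothesis for a proper prefix \<open>V\<close> of
      \<open>W\<close>; its other outcome is excluded by \<open>nb\<close>. It is needed for
      \<open>E\<close> and again for a smaller edge set, hence the edge set varies in the
      induction.\<close>
    have turn: "reach F a (last V)"
      if prems: "F \<subseteq> E" "trl F V" "W = V @ V'" "V \<noteq> []" "V' \<noteq> []" "reach F a (flip (last V))" for F V V'
    proof -
      obtain U' where U': "trl F U'" "U' \<noteq> []" "hd U' = a" "last U' = flip (last V)"
        using prems(6) by (auto simp: reach_def)
      have "reach F b (flip a) \<or> reach F a (last V)"
        by (rule less.hyps[OF _ U'(1-3) prems(2)]) (use prems W U' in auto)
      then show ?thesis using nb reach_mono prems(1) by blast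
    qed
    have trW1: "trl E W1" using W(1) W1 by (simp add: trl_append)
    have W1ne: "W1 \<noteq> []"
    proof
      assume "W1 = []"
      then have "b = flip al" using W W1 by simp
      moreover have "reach E a al" using U al_def by (auto simp: reach_def)
      ultimately show False using nb reach_flip by blast
    qed
    have alE: "ed al \<in> E" and fW1: "follows (last W1) (flip al)" and alW1: "ed al \<notin> ed ` set W1"
      using W(1) W1 W1ne by (auto simp: trl_append)
    have hdW1: "hd W1 = b" using W W1 W1ne by auto
    \<comment> \<open>After \<open>V\<close>, a trail from \<open>a\<close> to \<open>al\<close> is
      run backwards; by \<open>nb\<close> no edge-disjoint pair of this kind exists.\<close>
    have close_up: "reach E b (flip a)"
      if V: "trl E V" "V \<noteq> []" "hd V = b" "follows (last V) (flip al)"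
        and Z: "trl E (Z @ [al])" "hd (Z @ [al]) = a"
        and dis: "ed ` set V \<inter> ed ` set (Z @ [al]) = {}" for V Z
    proof (rule reachI)
      show "trl E (V @ rev (map flip (Z @ [al])))"
        unfolding trl_append[of E V] set_rev ed_image_flip
        using V trl_rev[OF Z(1)] dis by auto
      show "last (V @ rev (map flip (Z @ [al]))) = flip a"
        using Z(2) by (cases Z) (auto simp: last_rev hd_map)
    qed (use V in auto)
    have "ed ` set U \<inter> ed ` set W1 \<noteq> {}"
    proof
      assume dis: "ed ` set U \<inter> ed ` set W1 = {}"
      have "U = butlast U @ [al]" using U al_def by simp
      then show False
        using close_up[OF trW1 W1ne hdW1 fW1, of "butlast U"] U dis nb by (metis inf_commute)
    qed
    then have "reach E a (last W1)"
    proof (intro reach_along[OF trW1 W1ne _ U])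
      fix Va Vb assume *: "W1 = Va @ Vb" "Va \<noteq> []" "reach E a (flip (last Va))"
      show "reach E a (last Va)"
        by (rule turn[OF order_refl, of Va "Vb @ [flip al]"])
          (use * trW1 W1 in \<open>auto simp: trl_append\<close>)
    qed
    then obtain Y where Y: "trl E Y" "Y \<noteq> []" "hd Y = a" "last Y = last W1"
      by (auto simp: reach_def)
    have "ed (flip al) \<in> ed ` set Y"
      using reach_snoc[OF Y(1-3), of "flip al"] Y(4) fW1 alE na by auto
    moreover have "flip al \<notin> set Y" using reach_prefix[OF Y(1-3)] na by blast
    ultimately have "al \<in> set Y" by (auto simp: ed_in_image)
    then obtain Y0 L where YL: "Y = Y0 @ al # L" by (auto simp: in_set_conv_decomp)
    have Lne: "L \<noteq> []"
      using Y(4) YL alW1 W1ne last_in_set by fastforce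
    have lastL: "last L = last W1" using Y(4) YL Lne by simp
    have trY: "trl E (Y0 @ [al])" "trl E L" "follows al (hd L)"
      "ed ` set (Y0 @ [al]) \<inter> ed ` set L = {}"
      using Y(1) YL Lne trl_append[of E "Y0 @ [al]" L] by auto
    have hdY0: "hd (Y0 @ [al]) = a" using Y YL by (cases Y0) auto
    have Y0ne: "Y0 \<noteq> []"
    proof
      assume "Y0 = []"
      then have "a = al" using hdY0 by simp
      moreover have "reach E b (flip al)" using W lastW by (auto simp: reach_def)
      ultimately show False using nb by simp
    qed
    define F where "F = E - ed ` set L - {ed al}"
    have "F \<subseteq> E" by (auto simp: F_def)
    have "\<exists>w\<in>set W1. ed w \<in> ed ` set L"
    proof (rule bexI)
      show "last W1 \<in> set W1" using W1ne by simp
      show "ed (last W1) \<in> ed ` set L" unfolding lastL[symmetric] using Lne by simp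
    qed
    then obtain V w V' where V: "W1 = V @ w # V'" "ed w \<in> ed ` set L"
      "\<forall>v\<in>set V. ed v \<notin> ed ` set L"
      using split_list_first_prop[of W1 "\<lambda>w. ed w \<in> ed ` set L"] by blast
    have trV: "trl E V" "V \<noteq> [] \<Longrightarrow> follows (last V) w"
      using trW1 V(1) by (auto simp: trl_append)
    have "ed ` set V \<subseteq> F"
      using V(3) trV(1) alW1 V(1) by (auto simp: F_def trl_def)
    then have trVF: "trl F V" using trV(1) trl_restrict by blast
    \<comment> \<open>From \<open>w\<close> one can go round \<open>L\<close> in the direction that
      \<open>w\<close> prescribes. Both ends of the loop allow \<open>flip al\<close> next:
      \<open>last L\<close> is \<open>last W1\<close>, and the reverse of \<open>hd L\<close> works
      because \<open>hd L\<close> follows \<open>al\<close>.\<close>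
    obtain M where M: "trl E M" "M \<noteq> []" "hd M = w" "follows (last M) (flip al)"
      "ed ` set M \<subseteq> ed ` set L"
    proof -
      consider "w \<in> set L" | "flip w \<in> set L" using V(2) by (auto simp: ed_in_image)
      then show thesis
      proof cases
        case 1
        then obtain La Lb where "L = La @ w # Lb" by (auto simp: in_set_conv_decomp)
        then show thesis
          using that[of "w # Lb"] trY(2) lastL fW1 by (auto simp: trl_append)
      next
        case 2
        then obtain La Lb where L: "L = La @ flip w # Lb" by (auto simp: in_set_conv_decomp)
        define M where "M = rev (map flip (La @ [flip w]))"
        have "trl E (La @ [flip w])"
          using trY(2) L trl_append[of E "La @ [flip w]" Lb] by auto
        then have "trl E M" unfolding M_def by (rule trl_rev)
        moreover have "last M = flip (hd L)" using L unfolding M_def by (cases La) (auto simp: last_rev hd_map)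
        then have "follows (last M) (flip al)" using trY(3) by (simp add: follows_flip)
        moreover have "hd M = w" "M \<noteq> []" "ed ` set M \<subseteq> ed ` set L" using L by (auto simp: M_def)
        ultimately show thesis using that by blast
      qed
    qed
    have M_dis: "ed ` set (Y0 @ [al]) \<inter> ed ` set M = {}"
      by (rule disjoint_subsets[OF trY(4) order_refl M(5)])
    show False
    \<comment> \<open>If they are disjoint, \<open>V\<close>, then \<open>M\<close>, then the
      reverse of \<open>Y0 @ [al]\<close> lead from \<open>b\<close> to \<open>flip a\<close>.
      Otherwise \<open>reach_along\<close> applies within \<open>F\<close>, and its trail continues
      through \<open>M\<close> to \<open>flip al\<close>.\<close>
    proof (cases "ed ` set Y0 \<inter> ed ` set V = {}")
      case True
      have VL: "ed ` set V \<inter> ed ` set L = {}" using V(3) by auto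
      have VM: "ed ` set V \<inter> ed ` set M = {}"
        by (rule disjoint_subsets[OF VL order_refl M(5)])
      have "V \<noteq> [] \<Longrightarrow> follows (last V) (hd M)" using trV(2) M(3) by simp
      then have "trl E (V @ M)" unfolding trl_append[of E V] using trV(1) M(1) VM by blast
      have "ed al \<notin> ed ` set V" using alW1 V(1) by auto
      then have "ed ` set V \<inter> ed ` set (Y0 @ [al]) = {}"
        using True by (simp add: Int_commute)
      then have dis: "ed ` set (V @ M) \<inter> ed ` set (Y0 @ [al]) = {}"
        using M_dis unfolding set_append[of V] image_Un[of ed "set V"] Int_Un_distrib2
        by (simp only: Int_commute Un_empty_left)
      have "hd (V @ M) = b" using V(1) hdW1 M by (cases V) auto
      have "reach E b (flip a)"
        by (rule close_up[OF \<open>trl E (V @ M)\<close> _ \<open>hd (V @ M) = b\<close> _ trY(1) hdY0 dis])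
          (use M(2,4) in simp_all)
      then show False using nb by simp
    next
      case False
      then have "V \<noteq> []" by auto
      have "hd Y0 = a" using hdY0 Y0ne by simp
      have Y0: "trl E Y0" "ed al \<notin> ed ` set Y0" using trY(1) by (simp_all add: trl_append)
      have "ed ` set Y0 \<inter> ed ` set L = {}"
        by (rule disjoint_subsets[OF trY(4) _ order_refl]) auto
      then have "ed ` set Y0 \<subseteq> F"
        using Y0 unfolding F_def Diff_eq trl_def by (simp add: disjoint_eq_subset_Compl)
      then have "trl F Y0" using trl_restrict Y0(1) by blast
      have "reach F a (last V)"
      proof (rule reach_along[OF trVF \<open>V \<noteq> []\<close> _ \<open>trl F Y0\<close> Y0ne \<open>hd Y0 = a\<close> False])
        fix Va Vb assume *: "V = Va @ Vb" "Va \<noteq> []" "reach F a (flip (last Va))"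
        show "reach F a (last Va)"
          by (rule turn[OF \<open>F \<subseteq> E\<close>, of Va "Vb @ w # V' @ [flip al]"])
            (use * trVF V(1) W1 in \<open>auto simp: trl_append\<close>)
      qed
      then obtain Z where Z: "trl F Z" "Z \<noteq> []" "hd Z = a" "last Z = last V"
        by (auto simp: reach_def)
      have "ed ` set Z \<subseteq> F" using Z(1) by (simp add: trl_def)
      have FM: "F \<inter> ed ` set M = {}"
        by (rule disjoint_subsets[OF _ order_refl M(5)]) (auto simp: F_def)
      have Zdis: "ed ` set Z \<inter> ed ` set M = {}"
        by (rule disjoint_subsets[OF FM \<open>ed ` set Z \<subseteq> F\<close> order_refl])
      have alZ: "ed al \<notin> ed ` set Z" using \<open>ed ` set Z \<subseteq> F\<close> unfolding F_def by blast
      have "ed al \<notin> ed ` set M" using M_dis by auto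
      then have "trl E (M @ [flip al])"
        unfolding trl_append[of E M] using M(1,4) alE by simp
      moreover have "ed ` set Z \<inter> ed ` set (M @ [flip al]) = {}"
        using Zdis alZ by (simp add: Int_commute)
      moreover have "follows (last Z) (hd (M @ [flip al]))"
        using trV(2)[OF \<open>V \<noteq> []\<close>] Z(4) M(2,3) by simp
      ultimately have "trl E (Z @ M @ [flip al])"
        unfolding trl_append[of E Z] using trl_mono[OF Z(1) \<open>F \<subseteq> E\<close>] by simp
      then have "reach E a (flip al)" by (rule reachI) (use Z in auto)
      then show False using na by simp
    qed
  qed
qed

text \<open>An edge used twice must come back reversed, since heads are distinct. The arc just
  before its second use then ends at the head of the first use, or is the first use itself, where
  the signs would agree.\<close>

lemma distinct_ed_if_distinct_tgt:
  assumes "successively follows l" "distinct (map tgt l)"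
  shows "distinct (map ed l)"
  using assms
proof (induction l)
  case Nil
  then show ?case by simp
next
  case (Cons a l)
  have "ed a \<noteq> ed c" if c: "c \<in> set l" for c
  proof
    assume "ed a = ed c"
    moreover have "a \<noteq> c" using Cons.prems(2) c by auto
    ultimately have a: "a = flip c" by (simp add: ed_eq_iff)
    obtain l1 l2 where l: "l = l1 @ c # l2" using c by (auto simp: in_set_conv_decomp)
    show False
    proof (cases "l1 = []")
      case True
      then show False using Cons.prems(1) l a by (simp add: follows_def)
    next
      case False
      then have "follows (last l1) c"
        using Cons.prems(1) l by (simp add: successively_append_iff successively_Cons)
      then have "tgt (last l1) = tgt a" using a by (simp add: follows_def)
      then show False using Cons.prems(2) l False by (metis UnCI distinct.simps(2) image_eqI
          last_in_set list.set_map list.simps(9) set_append)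
    qed
  qed
  then show ?case
    using Cons by (auto simp: successively_Cons)
qed

end

section \<open>The structure of the arcs reachable from a clean root\<close>

locale clean_root = signed_arcs flip tgt sg
  for flip :: "'a \<Rightarrow> 'a" and tgt :: "'a \<Rightarrow> 'v" and sg :: "'a \<Rightarrow> sign" +
  fixes E :: "'a set set" and x :: 'v
  assumes clean: "ed b \<in> E \<Longrightarrow> tgt (flip b) = x \<Longrightarrow> reach E b a \<Longrightarrow> tgt a \<noteq> x"
begin

definition reachable :: "'a set" where
  "reachable = {a. \<exists>b. ed b \<in> E \<and> tgt (flip b) = x \<and> reach E b a}"

definition bi :: "'a \<Rightarrow> bool" where
  "bi a \<longleftrightarrow> a \<in> reachable \<and> flip a \<in> reachable"

text \<open>\<open>a\<close> will turn out to be the only reachable arc leading from outside into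
  the two-way component of \<open>b\<close>. Asking for a trail rather than mere connectedness
  allows it to be extended beyond \<open>b\<close>.\<close>

definition enters :: "'a \<Rightarrow> 'a \<Rightarrow> bool" where
  "enters a b \<longleftrightarrow> a \<in> reachable \<and> \<not> bi a \<and>
     (\<exists>l. trl E (a # l) \<and> l \<noteq> [] \<and> (\<forall>c\<in>set l. bi c) \<and> last l = b)"

lemma bi_flip [simp]: "bi (flip a) \<longleftrightarrow> bi a"
  by (auto simp: bi_def)

lemma bi_reachable: "bi a \<Longrightarrow> a \<in> reachable"
  by (simp add: bi_def)

lemma reachable_ed: "a \<in> reachable \<Longrightarrow> ed a \<in> E"
  by (auto simp: reachable_def reach_def trl_def)

lemma reachable_not_root: "a \<in> reachable \<Longrightarrow> tgt a \<noteq> x"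
  using clean by (auto simp: reachable_def)

lemma bi_not_root: "bi a \<Longrightarrow> tgt (flip a) \<noteq> x"
  by (auto simp: bi_def reachable_not_root)

lemma flip_notin_reachable: "a \<in> reachable \<Longrightarrow> \<not> bi a \<Longrightarrow> flip a \<notin> reachable"
  by (simp add: bi_def)

lemma root_reachable:
  assumes "trl E l" "l \<noteq> []" "tgt (flip (hd l)) = x" "a \<in> set l"
  shows "a \<in> reachable"
proof -
  have "ed (hd l) \<in> E" using assms(1,2) by (auto simp: trl_def)
  then show ?thesis
    using reach_prefix[OF assms(1,2) refl assms(4)] assms(3) by (auto simp: reachable_def)
qed

lemma reachableE:
  assumes "a \<in> reachable"
  obtains l where "trl E l" "l \<noteq> []" "tgt (flip (hd l)) = x" "last l = a"
  using assms by (auto simp: reachable_def reach_def)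

lemma ed_neq_bi: "\<not> bi a \<Longrightarrow> bi b \<Longrightarrow> ed a \<noteq> ed b"
  by (auto simp: ed_eq_iff)

text \<open>Follow a trail from \<open>x\<close> to \<open>b\<close> until it first meets an edge of
  a trail from \<open>b\<close> to \<open>c\<close>, then continue along the latter in the direction
  of that first contact. This ends in \<open>c\<close> or in \<open>flip b\<close>.\<close>

lemma reach_reachable:
  assumes "b \<in> reachable" "reach E b c"
  shows "c \<in> reachable \<or> flip b \<in> reachable"
proof -
  obtain T where T: "trl E T" "T \<noteq> []" "tgt (flip (hd T)) = x" "last T = b"
    using assms(1) by (rule reachableE)
  obtain V where V: "trl E V" "V \<noteq> []" "hd V = b" "last V = c"
    using assms(2) by (auto simp: reach_def)
  have "\<exists>t\<in>set T. ed t \<in> ed ` set V"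
    using T V by (metis hd_in_set image_eqI last_in_set)
  then obtain T1 t T2 where T': "T = T1 @ t # T2" "ed t \<in> ed ` set V" "\<forall>s\<in>set T1. ed s \<notin> ed ` set V"
    using split_list_first_prop[of T "\<lambda>t. ed t \<in> ed ` set V"] by blast
  have T1: "trl E T1" "T1 \<noteq> [] \<Longrightarrow> follows (last T1) t" using T(1) T'(1) by (auto simp: trl_append)
  have extend: "last M \<in> reachable"
    if M: "trl E M" "M \<noteq> []" "hd M = t" "ed ` set M \<subseteq> ed ` set V" for M
  proof (rule root_reachable)
    have TV: "ed ` set T1 \<inter> ed ` set V = {}" using T'(3) by auto
    have "ed ` set T1 \<inter> ed ` set M = {}"
      by (rule disjoint_subsets[OF TV order_refl M(4)])
    then show "trl E (T1 @ M)" unfolding trl_append using T1 M(1,3) by simp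
    show "tgt (flip (hd (T1 @ M))) = x" using T(3) T'(1) M by (cases T1) auto
  qed (use M in auto)
  consider "t \<in> set V" | "flip t \<in> set V" using T'(2) by (auto simp: ed_in_image)
  then show ?thesis
  proof cases
    case 1
    then obtain Va Vb where V': "V = Va @ t # Vb" by (auto simp: in_set_conv_decomp)
    then have "last (t # Vb) \<in> reachable"
      using V(1) by (intro extend) (auto simp: trl_append)
    then show ?thesis using V' V(4) by auto
  next
    case 2
    then obtain Va Vb where V': "V = Va @ flip t # Vb" by (auto simp: in_set_conv_decomp)
    have "trl E (Va @ [flip t])" using V(1) V' trl_append[of E "Va @ [flip t]" Vb] by auto
    then have "last (rev (map flip (Va @ [flip t]))) \<in> reachable"
      using V' by (intro extend[OF trl_rev]) auto
    then show ?thesis using V' V(3) by (cases Va) (auto simp: last_rev hd_map)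
  qed
qed

lemma reach_from_entry:
  assumes "a \<in> reachable" "\<not> bi a" "reach E a c"
  shows "c \<in> reachable"
  using reach_reachable[OF assms(1,3)] flip_notin_reachable[OF assms(1,2)] by blast

section \<open>Entries of two-way components\<close>

lemma enters_prefix:
  assumes "trl E (a # l)" "a \<in> reachable" "\<not> bi a" "\<forall>c\<in>set l. bi c" "b \<in> set l"
  shows "enters a b"
proof -
  obtain l1 l2 where l: "l = l1 @ b # l2" using assms(5) by (auto simp: in_set_conv_decomp)
  then have "trl E (a # l1 @ [b])"
    using assms(1) trl_append[of E "a # l1 @ [b]" l2] by auto
  then show ?thesis using assms(2-4) l unfolding enters_def by (intro conjI exI[of _ "l1 @ [b]"]) auto
qed

lemma enters_bi: "enters a b \<Longrightarrow> bi b"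
  by (auto simp: enters_def)

text \<open>Cleanness keeps two-way arcs away from \<open>x\<close>, so a trail from
  \<open>x\<close> to \<open>b\<close> begins with an arc that is not two-way. The last such arc is
  an entry.\<close>

lemma enters_exists:
  assumes "bi b"
  shows "\<exists>a. enters a b"
proof -
  obtain T where T: "trl E T" "T \<noteq> []" "tgt (flip (hd T)) = x" "last T = b"
    using assms by (metis bi_reachable reachableE)
  have "\<exists>t\<in>set T. \<not> bi t" using bi_not_root T(2,3) hd_in_set by blast
  then obtain T1 a l where T': "T = T1 @ a # l" "\<not> bi a" "\<forall>t\<in>set l. bi t"
    using split_list_last_prop[of T "\<lambda>t. \<not> bi t"] by auto
  have "l \<noteq> []" using T' T(4) assms by auto
  have "trl E (a # l)" using T(1) T'(1) by (simp add: trl_append)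
  moreover have "a \<in> reachable" using T T'(1) by (intro root_reachable[of T]) auto
  moreover have "b \<in> set l" using T(4) T'(1) \<open>l \<noteq> []\<close> by auto
  ultimately have "enters a b" using T' by (intro enters_prefix)
  then show ?thesis ..
qed

text \<open>\<open>flip b\<close> has some entry \<open>a2\<close>; suppose that it differs from
  \<open>a\<close>. Apply \<open>reach_dichotomy\<close> to the trail from \<open>a\<close> to
  \<open>b\<close> and to the trail after \<open>a2\<close> to \<open>flip b\<close>. If the
  latter's first arc reached \<open>flip a\<close>, so would \<open>a2\<close>, and \<open>a\<close>
  would be two-way. So \<open>a\<close> reaches \<open>flip b\<close>.\<close>

lemma enters_flip:
  assumes "enters a b"
  shows "enters a (flip b)"
proof -
  have "bi (flip b)" using assms enters_bi by simp
  then obtain a2 where "enters a2 (flip b)" using enters_exists by blast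
  then obtain l2 where l2: "trl E (a2 # l2)" "l2 \<noteq> []" "\<forall>c\<in>set l2. bi c" "last l2 = flip b"
    and a2: "a2 \<in> reachable" "\<not> bi a2"
    by (auto simp: enters_def)
  obtain l where l: "trl E (a # l)" "l \<noteq> []" "\<forall>c\<in>set l. bi c" "last l = b"
    and a: "a \<in> reachable" "\<not> bi a"
    using assms by (auto simp: enters_def)
  show ?thesis
  proof (cases "a2 = a")
    case True
    then show ?thesis using \<open>enters a2 (flip b)\<close> by simp
  next
    case False
    \<comment> \<open>\<open>F\<close> omits the edge of \<open>a2\<close>, so \<open>a2\<close> can
      be put in front of any trail in \<open>F\<close> whose first arc is \<open>hd l2\<close>. All
      its edges except that of \<open>a\<close> are two-way, so a trail in \<open>F\<close> starting
      with \<open>a\<close> has the form that \<open>enters\<close> requires.\<close>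
    define F where "F = ed ` set (a # l) \<union> ed ` set l2"
    have neq: "ed a2 \<noteq> ed a"
      using False a a2 by (auto simp: ed_eq_iff flip_notin_reachable)
    have "ed a2 \<notin> F"
      using neq l(3) l2(3) a2 ed_neq_bi by (auto simp: F_def)
    have "F \<subseteq> E" using l(1) l2(1) by (auto simp: F_def trl_def)
    have "trl F (a # l)" using l(1) by (rule trl_restrict) (auto simp: F_def)
    have "trl E l2" using l2(1) by (simp add: trl_Cons)
    then have "trl F l2" by (rule trl_restrict) (auto simp: F_def)
    have "reach F (hd l2) (flip a) \<or> reach F a (last l2)"
      by (rule reach_dichotomy[OF \<open>trl F (a # l)\<close> _ _ \<open>trl F l2\<close>]) (use l l2 in auto)
    then have "reach F a (flip b)"
    proof
      assume "reach F (hd l2) (flip a)"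
      then obtain V where V: "trl F V" "V \<noteq> []" "hd V = hd l2" "last V = flip a"
        by (auto simp: reach_def)
      have "follows a2 (hd V)" using l2(1,2) V(3) by (simp add: trl_Cons)
      moreover have "ed a2 \<notin> ed ` set V" using V(1) \<open>ed a2 \<notin> F\<close> by (auto simp: trl_def)
      ultimately have "trl E (a2 # V)"
        using trl_mono[OF V(1) \<open>F \<subseteq> E\<close>] reachable_ed[OF a2(1)] by (simp add: trl_Cons)
      then have "reach E a2 (flip a)" by (rule reachI) (use V in auto)
      then show ?thesis using reach_from_entry a2 a flip_notin_reachable by blast
    qed (use l2(4) in simp)
    then obtain V where V: "trl F V" "V \<noteq> []" "hd V = a" "last V = flip b"
      by (auto simp: reach_def)
    then obtain V' where V': "V = a # V'" by (cases V) auto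
    have "bi c" if "c \<in> set V'" for c
    proof -
      have "ed c \<in> F" "ed c \<noteq> ed a" using V(1) V' that by (auto simp: trl_Cons trl_def)
      then obtain d where "ed c = ed d" "bi d" using l(3) l2(3) by (auto simp: F_def)
      then show ?thesis by (auto simp: ed_eq_iff)
    qed
    moreover have "V' \<noteq> []" using V V' \<open>bi (flip b)\<close> a by auto
    moreover have "trl E (a # V')" using trl_mono[OF V(1) \<open>F \<subseteq> E\<close>] V' by simp
    ultimately show ?thesis using a V V' unfolding enters_def by auto
  qed
qed

text \<open>The trail from \<open>a\<close> to \<open>b\<close> can go on with \<open>flip c\<close>
  unless it already contains the edge of \<open>c\<close>. Either way a prefix ends in
  \<open>c\<close> or \<open>flip c\<close>, and \<open>enters_flip\<close> settles the
  orientation.\<close>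

lemma enters_follows:
  assumes "enters a b" "bi c" "tgt b = tgt c" "sg b \<noteq> sg c"
  shows "enters a c"
proof -
  obtain l where l: "trl E (a # l)" "l \<noteq> []" "\<forall>c\<in>set l. bi c" "last l = b"
    and a: "a \<in> reachable" "\<not> bi a"
    using assms(1) by (auto simp: enters_def)
  have "enters a (flip c)"
  proof (cases "ed c \<in> ed ` set l")
    case True
    then have "c \<in> set l \<or> flip c \<in> set l" by (simp add: ed_in_image)
    then show ?thesis using enters_prefix[OF l(1) a l(3)] enters_flip[of a c] by blast
  next
    case False
    have "ed c \<noteq> ed a" using ed_neq_bi a assms(2) by metis
    then have "trl E ((a # l) @ [flip c])"
      using l False assms reachable_ed[OF bi_reachable[OF assms(2)]]
      unfolding trl_append[of E "a # l"] by (auto simp: follows_def)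
    then show ?thesis using enters_prefix[of a "l @ [flip c]"] a l assms(2) by simp
  qed
  then show ?thesis using enters_flip by fastforce
qed

text \<open>The blossom property: the trail to \<open>b\<close> arrives at \<open>tgt b\<close> with
  sign \<open>sg b\<close>, and the trail to \<open>flip b\<close> without its last arc arrives
  there with the opposite sign. The second trail may consist of \<open>a\<close> alone.\<close>

lemma enters_other_sign:
  assumes "enters a b"
  obtains l where "trl E (a # l)" "\<forall>c\<in>set l. bi c" "tgt (last (a # l)) = tgt b" "sg (last (a # l)) \<noteq> s"
proof -
  obtain l where l: "trl E (a # l)" "l \<noteq> []" "\<forall>c\<in>set l. bi c" "last l = b"
    using assms by (auto simp: enters_def)
  show thesis
  proof (cases "sg b = s")
    case False
    then show thesis using l that[of l] by simp
  next
    case True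
    obtain m where m: "trl E (a # m)" "m \<noteq> []" "\<forall>c\<in>set m. bi c" "last m = flip b"
      using enters_flip[OF assms] by (auto simp: enters_def)
    then have "(a # butlast m) @ [flip b] = a # m" using append_butlast_last_id[of m] by simp
    then have m': "trl E ((a # butlast m) @ [flip b])" using m(1) by (simp only:)
    then have "trl E (a # butlast m)" "follows (last (a # butlast m)) (flip b)"
      unfolding trl_append[of E "a # butlast m"] by auto
    then show thesis using m(3) True
      by (intro that[of "butlast m"]) (auto simp: follows_def dest: in_set_butlastD)
  qed
qed

lemma enters_tgt:
  assumes "enters a b" "bi c" "tgt b = tgt c"
  shows "enters a c"
proof -
  obtain l where l: "trl E (a # l)" "\<forall>c\<in>set l. bi c" "tgt (last (a # l)) = tgt b"
    "sg (last (a # l)) \<noteq> sg c"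
    using enters_other_sign[OF assms(1)] by blast
  have a: "a \<in> reachable" "\<not> bi a" using assms(1) by (auto simp: enters_def)
  show ?thesis
  proof (cases "l = []")
    case False
    then have "enters a (last l)" using enters_prefix[OF l(1) a l(2)] by simp
    then show ?thesis using enters_follows assms l False by simp
  next
    case True
    then have "trl E [a, flip c]"
      using assms l ed_neq_bi[OF a(2) assms(2)] reachable_ed[OF a(1)]
        reachable_ed[OF bi_reachable[OF assms(2)]]
      by (auto simp: trl_Cons follows_def)
    then have "enters a (flip c)" using enters_prefix[of a "[flip c]"] a assms(2) by simp
    then show ?thesis using enters_flip by fastforce
  qed
qed

text \<open>A trail from \<open>a\<close> can arrive at the head of \<open>c\<close> with the sign
  opposite to that of \<open>c\<close> and leave along \<open>flip c\<close>, which would make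
  \<open>c\<close> two-way.\<close>

lemma entry_unique:
  assumes "enters a b" "c \<in> reachable" "\<not> bi c" "tgt c = tgt b"
  shows "c = a"
proof (rule ccontr)
  assume "c \<noteq> a"
  obtain l where l: "trl E (a # l)" "\<forall>c\<in>set l. bi c" "tgt (last (a # l)) = tgt b"
    "sg (last (a # l)) \<noteq> sg c"
    using enters_other_sign[OF assms(1)] by blast
  have a: "a \<in> reachable" "\<not> bi a" using assms(1) by (auto simp: enters_def)
  have "ed c \<noteq> ed a"
    using \<open>c \<noteq> a\<close> a assms by (auto simp: ed_eq_iff flip_notin_reachable)
  then have "ed c \<notin> ed ` set (a # l)" using l(2) ed_neq_bi[OF assms(3)] by auto
  then have "reach E a (flip c)"
    using l assms(4) reachable_ed[OF assms(2)]
    by (intro reach_snoc[OF l(1)]) (auto simp: follows_def)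
  then show False using reach_from_entry a flip_notin_reachable assms(2,3) by blast
qed

text \<open>A trail from \<open>x\<close> to \<open>a\<close> can turn into \<open>flip b\<close>
  unless it already uses the edge of \<open>b\<close>. If it uses \<open>b\<close> itself, its part
  up to \<open>b\<close> can turn into \<open>flip a\<close> instead.\<close>

lemma reachable_signs:
  assumes "a \<in> reachable" "b \<in> reachable" "tgt a = tgt b" "sg a \<noteq> sg b"
  shows "bi a \<or> bi b"
proof -
  obtain T where T: "trl E T" "T \<noteq> []" "tgt (flip (hd T)) = x" "last T = a"
    using assms(1) by (rule reachableE)
  have root: "c \<in> reachable" if "trl E (l @ [c])" "l \<noteq> []" "hd l = hd T" for l c
    by (rule root_reachable[OF that(1)]) (use that T in auto)
  have edE: "ed a \<in> E" "ed b \<in> E" using assms reachable_ed by auto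
  consider "b \<in> set T" | "flip b \<in> set T" | "ed b \<notin> ed ` set T" by (auto simp: ed_in_image)
  then show ?thesis
  proof cases
    case 1
    then obtain T1 T2 where T': "T = T1 @ b # T2" by (auto simp: in_set_conv_decomp)
    have "T2 \<noteq> []" using T' T(4) assms(4) by auto
    then have "a \<in> set T2" using T' T(4) by auto
    then have "ed a \<notin> ed ` set (T1 @ [b])" "trl E (T1 @ [b])"
      using T(1) T' trl_append[of E "T1 @ [b]" T2] by auto
    then have "trl E ((T1 @ [b]) @ [flip a])"
      using assms edE unfolding trl_append[of E "T1 @ [b]"] by (auto simp: follows_def)
    then have "flip a \<in> reachable" by (rule root) (use T' in \<open>auto simp: hd_append\<close>)
    then show ?thesis using assms(1) by (simp add: bi_def)
  next
    case 2
    then have "flip b \<in> reachable" using root_reachable T by blast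
    then show ?thesis using assms(2) by (simp add: bi_def)
  next
    case 3
    then have "trl E (T @ [flip b])"
      using T assms edE by (auto simp: trl_append follows_def)
    then have "flip b \<in> reachable" by (rule root) (use T in auto)
    then show ?thesis using assms(2) by (simp add: bi_def)
  qed
qed

section \<open>Contracting the two-way components\<close>

text \<open>The classes of this relation are the vertices of the contracted digraph. A vertex
  without two-way edges is a class by itself.\<close>

definition linked :: "'v \<Rightarrow> 'v \<Rightarrow> bool" where
  "linked = (\<lambda>v w. \<exists>c. bi c \<and> tgt (flip c) = v \<and> tgt c = w)\<^sup>*\<^sup>*"

lemma linked_refl [simp]: "linked v v"
  by (simp add: linked_def)

lemma linked_trans: "linked u v \<Longrightarrow> linked v w \<Longrightarrow> linked u w"
  unfolding linked_def by (rule rtranclp_trans)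

lemma linked_sym:
  assumes "linked v w"
  shows "linked w v"
proof -
  have "symp (\<lambda>v w. \<exists>c. bi c \<and> tgt (flip c) = v \<and> tgt c = w)"
  proof (rule sympI)
    fix v w assume "\<exists>c. bi c \<and> tgt (flip c) = v \<and> tgt c = w"
    then obtain c where "bi c" "tgt (flip c) = v" "tgt c = w" by blast
    then show "\<exists>c. bi c \<and> tgt (flip c) = w \<and> tgt c = v"
      by (intro exI[of _ "flip c"]) simp
  qed
  from sympD[OF symp_rtranclp[OF this]] show ?thesis using assms unfolding linked_def .
qed

lemma linked_segment:
  assumes "successively follows (a # l)" "\<forall>c\<in>set l. bi c" "b \<in> set (a # l)"
  shows "linked (tgt a) (tgt b)"
  using assms
proof (induction l arbitrary: a)
  case Nil
  then show ?case by simp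
next
  case (Cons c l)
  have "linked (tgt a) (tgt c)"
    using Cons.prems unfolding linked_def by (intro r_into_rtranclp) (auto simp: follows_def)
  moreover have "linked (tgt c) (tgt b)" if "b \<noteq> a"
    using Cons.IH[of c] Cons.prems that by auto
  ultimately show ?case using linked_trans by (cases "b = a") auto
qed

text \<open>Along each two-way arc from \<open>v\<close> to \<open>w\<close> the entry is passed on:
  \<open>enters_tgt\<close> moves to an arc with the same head, \<open>enters_flip\<close> crosses
  its edge.\<close>

lemma linked_enters:
  assumes "linked v w" "enters a b" "tgt b = v"
  shows "\<exists>c. enters a c \<and> tgt c = w"
  using assms(1) unfolding linked_def
proof (induction rule: rtranclp_induct)
  case base
  then show ?case using assms by blast
next
  case (step u w)
  then obtain b c where "enters a b" "tgt b = u" "bi c" "tgt (flip c) = u" "tgt c = w" by blast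
  then show ?case using enters_tgt[of a b "flip c"] enters_flip[of a "flip c"] by auto
qed

lemma enters_linked:
  assumes "enters a b"
  shows "linked (tgt a) (tgt b)"
proof -
  obtain l where "trl E (a # l)" "l \<noteq> []" "\<forall>c\<in>set l. bi c" "last l = b"
    using assms by (auto simp: enters_def)
  then show ?thesis using linked_segment[of a l b] by (auto simp: trl_def)
qed

lemma entry_unique_linked:
  assumes "enters a b" "c \<in> reachable" "\<not> bi c" "linked (tgt a) (tgt c)"
  shows "c = a"
proof -
  have "linked (tgt b) (tgt c)" 
    by (rule linked_trans[OF linked_sym[OF enters_linked[OF assms(1)]] assms(4)])
  then obtain d where "enters a d" "tgt d = tgt c" using linked_enters assms(1) by blast
  then show ?thesis using entry_unique assms(2,3) by metis
qed

lemma enters_unique: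
  assumes "enters a b" "enters c b"
  shows "c = a"
proof (rule entry_unique_linked[OF assms(1)])
  show "linked (tgt a) (tgt c)"
    by (rule linked_trans[OF enters_linked[OF assms(1)] linked_sym[OF enters_linked[OF assms(2)]]])
qed (use assms(2) in \<open>simp_all add: enters_def\<close>)

lemma enters_unique_ed:
  assumes "enters a b" "enters c d" "ed b = ed d"
  shows "c = a"
proof -
  have "enters a d" using assms(1,3) enters_flip[OF assms(1)] by (auto simp: ed_eq_iff)
  then show ?thesis using assms(2) by (rule enters_unique)
qed

lemma enters_segment:
  assumes "successively follows (a # l)" "distinct (map tgt (a # l))" "a \<in> reachable" "\<not> bi a"
    "\<forall>c\<in>set l. bi c" "b \<in> set l"
  shows "enters a b"
proof (rule enters_prefix[OF _ assms(3-6)])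
  have "set (a # l) \<subseteq> reachable" using assms(3,5) bi_reachable by auto
  then have "ed ` set (a # l) \<subseteq> E" using reachable_ed by (meson image_subsetI subsetD)
  then show "trl E (a # l)"
    unfolding trl_def using assms(1) distinct_ed_if_distinct_tgt[OF assms(1,2)] by simp
qed

text \<open>A class with two-way edges has a single entry. Any other class is one vertex, where
  \<open>reachable_signs\<close> forces equal signs. In both cases \<open>a\<close> can take the
  place of \<open>c\<close>, which the replacement lemmas below exploit.\<close>

lemma linked_entries:
  assumes "a \<in> reachable" "\<not> bi a" "c \<in> reachable" "\<not> bi c" "linked (tgt a) (tgt c)"
  shows "c = a \<or> tgt c = tgt a \<and> sg c = sg a \<and> (\<forall>d. bi d \<longrightarrow> tgt d \<noteq> tgt a)"
proof (cases "\<exists>d. bi d \<and> tgt d = tgt a")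
  case True
  then obtain d e where "tgt d = tgt a" "enters e d" using enters_exists by blast
  then show ?thesis using entry_unique[of e d a] entry_unique_linked[of e d c] assms by auto
next
  case False
  have "tgt a = tgt c"
    using assms(5) unfolding linked_def
  proof (cases rule: converse_rtranclpE)
    case (step u)
    then show ?thesis using False by (metis bi_flip)
  qed
  then show ?thesis using reachable_signs[of a c] assms False by metis
qed

text \<open>This is the line digraph of the contracted digraph, so edge-disjoint paths become
  vertex-disjoint walks. The path joining \<open>a\<close> to \<open>b\<close> stays inside one linkage class.\<close>

definition step :: "'a \<Rightarrow> 'a \<Rightarrow> bool" where
  "step a b \<longleftrightarrow> a \<in> reachable \<and> \<not> bi a \<and> b \<in> reachable \<and> \<not> bi b \<and>
     (\<exists>l. successively follows (a # l @ [b]) \<and> (\<forall>c\<in>set l. bi c) \<and> distinct (map tgt (a # l)))"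

text \<open>\<open>y\<close> may lie inside a contracted class, so the last arc of a walk need not
  end at \<open>y\<close>; the list \<open>l\<close> is the remaining stretch within the
  class.\<close>

definition final :: "'v \<Rightarrow> 'a \<Rightarrow> bool" where
  "final y a \<longleftrightarrow> a \<in> reachable \<and> \<not> bi a \<and>
     (\<exists>l. successively follows (a # l) \<and> (\<forall>c\<in>set l. bi c) \<and> distinct (map tgt (a # l)) \<and>
        tgt (last (a # l)) = y)"

text \<open>The runs of two-way arcs between the other arcs of a path are themselves the witnesses
  \<open>l\<close> in \<open>step\<close> and \<open>final\<close>. The induction cuts off the first
  run.\<close>

lemma project:
  assumes "successively follows (a # q)" "set (a # q) \<subseteq> reachable" "\<not> bi a"
    "distinct (map tgt (a # q))" "tgt (last (a # q)) = y"
  shows "successively step (filter (\<lambda>c. \<not> bi c) (a # q)) \<and>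
    final y (last (filter (\<lambda>c. \<not> bi c) (a # q)))"
  using assms
proof (induction "length q" arbitrary: a q rule: less_induct)
  case less
  define l where "l = takeWhile bi q"
  have l: "\<forall>c\<in>set l. bi c" by (auto simp: l_def dest: set_takeWhileD)
  show ?case
  proof (cases "dropWhile bi q")
    case Nil
    then have "q = l" by (metis append.right_neutral l_def takeWhile_dropWhile_id)
    moreover from this l have "filter (\<lambda>c. \<not> bi c) q = []" by auto
    ultimately show ?thesis using less.prems l by (auto simp: final_def)
  next
    case (Cons b q')
    then have q: "q = l @ b # q'" by (metis l_def takeWhile_dropWhile_id)
    have "\<not> bi b" using Cons by (metis dropWhile_eq_Cons_conv)
    have fl: "filter (\<lambda>c. \<not> bi c) (a # q) = a # filter (\<lambda>c. \<not> bi c) (b # q')"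
      using q l less.prems(3) by auto
    have "successively follows ((a # l) @ b # q')" using less.prems(1) q by simp
    then have fol: "successively follows (b # q')"
      unfolding successively_append_iff[of follows "a # l"] by blast
    have IH: "successively step (filter (\<lambda>c. \<not> bi c) (b # q')) \<and>
        final y (last (filter (\<lambda>c. \<not> bi c) (b # q')))"
    proof (rule less.hyps[OF _ fol _ \<open>\<not> bi b\<close>])
      show "length q' < length q" "set (b # q') \<subseteq> reachable" "distinct (map tgt (b # q'))"
        "tgt (last (b # q')) = y"
        using less.prems(2,4,5) q by simp_all
    qed
    have "successively follows ((a # l @ [b]) @ q')" using less.prems(1) q by simp
    then have "successively follows (a # l @ [b])"
      unfolding successively_append_iff[of follows "a # l @ [b]"] by blast
    moreover have "distinct (map tgt (a # l))" using less.prems(4) q by simp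
    ultimately have "step a b"
      using less.prems(2,3) q l \<open>\<not> bi b\<close> unfolding step_def by (intro conjI exI[of _ l]) simp_all
    then show ?thesis using IH fl \<open>\<not> bi b\<close> by simp
  qed
qed

text \<open>If \<open>c\<close> differs from \<open>a\<close>, the class has no two-way edges, so
  the connecting segment is empty and only head and sign matter, in which \<open>a\<close> and
  \<open>c\<close> agree.\<close>

lemma step_replace:
  assumes "a \<in> reachable" "\<not> bi a" "linked (tgt a) (tgt c)" "step c b"
  shows "step a b"
proof -
  have c: "c \<in> reachable" "\<not> bi c" using assms(4) by (auto simp: step_def)
  show ?thesis
  proof (cases "c = a")
    case False
    then have ca: "tgt c = tgt a" "sg c = sg a" "\<forall>d. bi d \<longrightarrow> tgt d \<noteq> tgt a"
      using linked_entries[OF assms(1,2) c assms(3)] by auto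
    obtain l where l: "successively follows (c # l @ [b])" "\<forall>c\<in>set l. bi c"
      using assms(4) by (auto simp: step_def)
    have "l = []"
    proof (cases l)
      case (Cons d l')
      then have "tgt (flip d) = tgt a" "bi (flip d)" using l ca(1) by (auto simp: follows_def)
      then show ?thesis using ca(3) by blast
    qed
    then have "follows a b" using l ca by (simp add: follows_def)
    then show ?thesis
      using assms unfolding step_def by (auto intro!: exI[of _ "[]"])
  qed (use assms in simp)
qed

lemma final_replace:
  assumes "a \<in> reachable" "\<not> bi a" "linked (tgt a) (tgt c)" "final y c"
  shows "final y a"
proof -
  have c: "c \<in> reachable" "\<not> bi c" using assms(4) by (auto simp: final_def)
  show ?thesis
  proof (cases "c = a")
    case False
    then have ca: "tgt c = tgt a" "\<forall>d. bi d \<longrightarrow> tgt d \<noteq> tgt a"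
      using linked_entries[OF assms(1,2) c assms(3)] by auto
    obtain l where l: "successively follows (c # l)" "\<forall>c\<in>set l. bi c" "tgt (last (c # l)) = y"
      using assms(4) by (auto simp: final_def)
    have "l = []"
    proof (cases l)
      case (Cons d l')
      then have "tgt (flip d) = tgt a" "bi (flip d)" using l ca(1) by (auto simp: follows_def)
      then show ?thesis using ca(2) by blast
    qed
    then show ?thesis
      using assms l(3) ca(1) unfolding final_def by (auto intro!: exI[of _ "[]"])
  qed (use assms in simp)
qed

lemma walk_nonbi:
  assumes "successively step ws" "final y (last ws)" "c \<in> set ws"
  shows "c \<in> reachable \<and> \<not> bi c"
proof -
  obtain w1 w2 where "ws = w1 @ c # w2" using assms(3) by (auto simp: in_set_conv_decomp)
  then show ?thesis
    using assms(1,2) by (cases w2) (auto simp: successively_append_iff step_def final_def)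
qed

text \<open>If a later arc enters the class of the first arc \<open>a\<close>, the part between is
  cut out with \<open>step_replace\<close>. If none does, the segment of \<open>a\<close> is put in
  front of the lifted rest: all heads of the rest lie in classes entered by later arcs, hence differ
  from those of the segment. The last clause records which class each arc belongs to and later
  yields edge-disjointness.\<close>

lemma lift:
  assumes "successively step ws" "ws \<noteq> []" "final y (last ws)"
  shows "\<exists>p. p \<noteq> [] \<and> hd p = hd ws \<and> successively follows p \<and> distinct (map tgt p) \<and>
    set p \<subseteq> reachable \<and> tgt (last p) = y \<and>
    (\<forall>c\<in>set p. c \<in> set ws \<or> (\<exists>a\<in>set ws. enters a c))"
  using assms
proof (induction "length ws" arbitrary: ws rule: less_induct)
  case less
  obtain a ws' where ws: "ws = a # ws'" using less.prems(2) by (cases ws) auto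
  have a: "a \<in> reachable" "\<not> bi a"
    using walk_nonbi[OF less.prems(1,3), of a] ws by simp_all
  consider "ws' = []"
    | c where "ws' \<noteq> []" "c \<in> set ws'" "linked (tgt a) (tgt c)"
    | "ws' \<noteq> []" "\<forall>c\<in>set ws'. \<not> linked (tgt a) (tgt c)"
    by blast
  then show ?case
  proof cases
    case 1
    then obtain l where l: "successively follows (a # l)" "\<forall>c\<in>set l. bi c"
      "distinct (map tgt (a # l))" "tgt (last (a # l)) = y"
      using less.prems ws by (auto simp: final_def)
    have "\<forall>c\<in>set l. enters a c" using enters_segment l a by blast
    then show ?thesis using l ws a bi_reachable by (intro exI[of _ "a # l"]) auto
  next
    case 2
    then obtain w1 w2 where w: "ws' = w1 @ c # w2" by (auto simp: in_set_conv_decomp)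
    have "successively step (a # w2)"
      using less.prems(1) ws w step_replace[OF a 2(3)]
      by (cases w2) (auto simp: successively_append_iff successively_Cons)
    moreover have "final y (last (a # w2))"
      using less.prems(3) ws w final_replace[OF a 2(3)] by auto
    ultimately obtain p where p: "p \<noteq> []" "hd p = a" "successively follows p"
      "distinct (map tgt p)" "set p \<subseteq> reachable" "tgt (last p) = y"
      "\<forall>c\<in>set p. c \<in> set (a # w2) \<or> (\<exists>a\<in>set (a # w2). enters a c)"
      using less.hyps[of "a # w2"] ws w by auto
    have "set (a # w2) \<subseteq> set ws" using ws w by auto
    then have "\<forall>c\<in>set p. c \<in> set ws \<or> (\<exists>a\<in>set ws. enters a c)" using p(7) by blast
    then show ?thesis using p(1-6) ws by (intro exI[of _ p]) simp
  next
    case 3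
    have "step a (hd ws')" "successively step ws'"
      using less.prems(1) ws 3(1) by (auto simp: successively_Cons)
    then obtain l where l: "successively follows (a # l @ [hd ws'])" "\<forall>c\<in>set l. bi c"
      "distinct (map tgt (a # l))"
      by (auto simp: step_def)
    obtain p where p: "p \<noteq> []" "hd p = hd ws'" "successively follows p" "distinct (map tgt p)"
      "set p \<subseteq> reachable" "tgt (last p) = y"
      "\<forall>c\<in>set p. c \<in> set ws' \<or> (\<exists>a\<in>set ws'. enters a c)"
      using less.hyps[of ws'] less.prems ws 3(1) \<open>successively step ws'\<close> by auto
    have l': "successively follows ((a # l) @ [hd ws'])" using l(1) by simp
    then have al: "successively follows (a # l)" "follows (last (a # l)) (hd ws')"
      unfolding successively_append_iff by auto
    have ent: "\<forall>c\<in>set l. enters a c" using enters_segment al(1) l(2,3) a by blast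
    have "successively follows ((a # l) @ p)"
      unfolding successively_append_iff using al p(2,3) by auto
    moreover have "tgt b \<noteq> tgt c" if bc: "b \<in> set (a # l)" "c \<in> set p" for b c
    proof
      assume eq: "tgt b = tgt c"
      have "linked (tgt a) (tgt c)" using linked_segment[OF al(1) l(2) bc(1)] eq by simp
      moreover obtain d where "d \<in> set ws'" "linked (tgt d) (tgt c)"
        using p(7) bc(2) enters_linked linked_refl by blast
      ultimately have "linked (tgt a) (tgt d)" using linked_trans[OF _ linked_sym] by blast
      then show False using 3(2) \<open>d \<in> set ws'\<close> by blast
    qed
    then have "tgt ` set (a # l) \<inter> tgt ` set p = {}" by blast
    then have "distinct (map tgt ((a # l) @ p))"
      using l(3) p(4) unfolding map_append distinct_append set_map by blast
    moreover have "set ((a # l) @ p) \<subseteq> reachable" using a l(2) p(5) bi_reachable by auto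
    moreover have "\<forall>c\<in>set ((a # l) @ p). c \<in> set ws \<or> (\<exists>a\<in>set ws. enters a c)"
      using ent p(7) ws by auto
    ultimately show ?thesis
      using p(1,6) ws by (intro exI[of _ "(a # l) @ p"]) simp
  qed
qed

end

section \<open>Augmenting disjoint walks in a digraph\<close>

text \<open>Vertices may repeat, since \<open>lift\<close> produces paths from arbitrary walks.
  Meeting \<open>X\<close> only at the start makes it safe to prepend segments that lie in
  \<open>X\<close>.\<close>

definition walk_from_to :: "('a \<Rightarrow> 'a \<Rightarrow> bool) \<Rightarrow> 'a set \<Rightarrow> 'a set \<Rightarrow> 'a list \<Rightarrow> bool" where
  "walk_from_to r X Y l \<longleftrightarrow>
     l \<noteq> [] \<and> hd l \<in> X \<and> set (tl l) \<inter> X = {} \<and> last l \<in> Y \<and> successively r l"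

text \<open>Indexing the walks by their starting points turns keeping the old starting points into
  inclusion of index sets.\<close>

definition linkage :: "('a \<Rightarrow> 'a \<Rightarrow> bool) \<Rightarrow> 'a set \<Rightarrow> 'a set \<Rightarrow> 'a set \<Rightarrow> ('a \<Rightarrow> 'a list) \<Rightarrow> bool" where
  "linkage r X Y F p \<longleftrightarrow> (\<forall>s\<in>F. walk_from_to r X Y (p s) \<and> hd (p s) = s) \<and>
     (\<forall>s\<in>F. \<forall>t\<in>F. s \<noteq> t \<longrightarrow> set (p s) \<inter> set (p t) = {})"

lemma walk_from_to_trim:
  assumes "l \<noteq> []" "hd l \<in> X" "last l \<in> Y" "successively r l"
  shows "\<exists>m. walk_from_to r X Y m \<and> set m \<subseteq> set l"
proof -
  have "\<exists>s\<in>set l. s \<in> X" using assms by auto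
  then obtain l1 s l2 where l: "l = l1 @ s # l2" "s \<in> X" "\<forall>t\<in>set l2. t \<notin> X"
    using split_list_last_prop[of l "\<lambda>s. s \<in> X"] by blast
  have "walk_from_to r X Y (s # l2)"
    using assms l by (auto simp: walk_from_to_def successively_append_iff)
  then show ?thesis using l(1) by (intro exI[of _ "s # l2"]) auto
qed

lemma walk_from_to_prepend:
  assumes "walk_from_to r X' Y m" "X \<subseteq> X'" "successively r (l @ [hd m])"
    "hd (l @ [hd m]) \<in> X" "set (tl (l @ [hd m])) \<inter> X = {}"
  shows "walk_from_to r X Y (l @ m) \<and> hd (l @ m) = hd (l @ [hd m])"
proof -
  obtain z t where m: "m = z # t" using assms(1) by (cases m) (auto simp: walk_from_to_def)
  have "set (tl (l @ m)) \<subseteq> set (tl (l @ [z])) \<union> set t"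
    using m by (cases l) auto
  moreover have "set t \<inter> X = {}" using assms(1,2) m by (auto simp: walk_from_to_def)
  ultimately have "set (tl (l @ m)) \<inter> X = {}" using assms(5) m by auto
  moreover have "hd (l @ m) = hd (l @ [hd m])" using m by (cases l) auto
  moreover have "successively r (l @ m)"
    using assms(1,3) m by (auto simp: walk_from_to_def successively_append_iff)
  ultimately show ?thesis using assms(1,4) m by (auto simp: walk_from_to_def)
qed

text \<open>Undoes an enlargement of the source set from \<open>X\<close> to \<open>X'\<close>. The
  segments \<open>A\<close> and \<open>B\<close> lie in \<open>X'\<close>, which the walks of
  \<open>q\<close> meet only at their starts, so prepending them keeps the walks disjoint.\<close>

lemma linkage_splice:
  assumes q: "linkage r X' Y (insert u (insert z G)) q" and "X \<subseteq> X'" "u \<noteq> z" "u \<notin> G" "z \<notin> G"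
    and A: "successively r (A @ [z])" "hd (A @ [z]) \<in> X" "set (tl (A @ [z])) \<inter> X = {}"
    and B: "successively r (B @ [u])" "hd (B @ [u]) \<in> X" "set (tl (B @ [u])) \<inter> X = {}"
    and AB: "set A \<union> set B \<subseteq> X'" "set A \<inter> set B = {}" "(set A \<union> set B) \<inter> insert u (insert z G) = {}"
    and "G \<subseteq> X"
  shows "\<exists>p. linkage r X Y (insert (hd (A @ [z])) (insert (hd (B @ [u])) G)) p"
proof -
  let ?a = "hd (A @ [z])" and ?b = "hd (B @ [u])"
  have w: "walk_from_to r X' Y (q s)" "hd (q s) = s" if "s \<in> insert u (insert z G)" for s
    using q that by (auto simp: linkage_def)
  have dis: "set (q s) \<inter> set (q t) = {}"
    if "s \<in> insert u (insert z G)" "t \<in> insert u (insert z G)" "s \<noteq> t" for s t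
    using q that unfolding linkage_def by blast
  have only: "set (q s) \<inter> X' \<subseteq> {s}" if "s \<in> insert u (insert z G)" for s
    using w[OF that] by (cases "q s") (auto simp: walk_from_to_def)
  have "?a \<in> insert z (set A)" by (cases A) simp_all
  moreover have "?b \<in> insert u (set B)" by (cases B) simp_all
  ultimately have ne: "?a \<notin> G" "?b \<notin> G" "?a \<noteq> ?b"
    using AB(2,3) assms(3-5) by auto
  have wA: "walk_from_to r X Y (A @ q z) \<and> hd (A @ q z) = ?a"
    using walk_from_to_prepend[OF w(1)[of z] assms(2)] A w(2)[of z] by simp
  have wB: "walk_from_to r X Y (B @ q u) \<and> hd (B @ q u) = ?b"
    using walk_from_to_prepend[OF w(1)[of u] assms(2)] B w(2)[of u] by simp
  have wG: "walk_from_to r X Y (q s) \<and> hd (q s) = s" if "s \<in> G" for s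
    using w[of s] that assms(2) \<open>G \<subseteq> X\<close> by (auto simp: walk_from_to_def)
  have dAB: "set (A @ q z) \<inter> set (B @ q u) = {}"
    using dis[of z u] only[of z] only[of u] AB assms(3) by auto
  have dA: "set (A @ q z) \<inter> set (q s) = {}" if "s \<in> G" for s
    using dis[of z s] only[of s] AB assms(5) that by auto
  have dB: "set (B @ q u) \<inter> set (q s) = {}" if "s \<in> G" for s
    using dis[of u s] only[of s] AB assms(4) that by auto
  define p where "p = q(?a := A @ q z, ?b := B @ q u)"
  have p: "p ?a = A @ q z" "p ?b = B @ q u" "\<And>s. s \<in> G \<Longrightarrow> p s = q s"
    using ne by (auto simp: p_def)
  have "linkage r X Y (insert ?a (insert ?b G)) p"
    unfolding linkage_def
  proof (intro conjI ballI impI)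
    fix s assume "s \<in> insert ?a (insert ?b G)"
    then show "walk_from_to r X Y (p s)" "hd (p s) = s" using p wA wB wG by auto
  next
    fix s t assume "s \<in> insert ?a (insert ?b G)" "t \<in> insert ?a (insert ?b G)" "s \<noteq> t"
    then consider "s = ?a" "t = ?b" | "s = ?b" "t = ?a" | "s = ?a" "t \<in> G" | "t = ?a" "s \<in> G"
      | "s = ?b" "t \<in> G" | "t = ?b" "s \<in> G" | "s \<in> G" "t \<in> G" by blast
    then show "set (p s) \<inter> set (p t) = {}"
    proof cases
      case 1
      then show ?thesis using dAB p by simp
    next
      case 2
      then show ?thesis using dAB p by (simp only: Int_commute)
    next
      case 3
      then show ?thesis using dA p by simp
    next
      case 4
      then show ?thesis using dA p by (simp only: Int_commute)
    next
      case 5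
      then show ?thesis using dB p by simp
    next
      case 6
      then show ?thesis using dB p by (simp only: Int_commute)
    next
      case 7
      then show ?thesis using dis[of s t] p \<open>s \<noteq> t\<close> by simp
    qed
  qed
  then show ?thesis by blast
qed

text \<open>A walk \<open>R\<close> avoiding the starting points in \<open>F\<close> first meets the family in a vertex \<open>z\<close> of some
  \<open>p s0\<close>. Both initial segments up to \<open>z\<close> are added to the source set and \<open>p s0\<close> is cut off before
  \<open>z\<close>, which shortens the family.\<close>

lemma linkage_augment:
  assumes "finite F" "linkage r X Y F p" "\<forall>s\<in>F. distinct (p s) \<and> set (p s) \<subseteq> N"
    and "\<And>S. S \<subseteq> N \<Longrightarrow> finite S \<Longrightarrow> card S = card F \<Longrightarrow> \<exists>R. walk_from_to r X Y R \<and> set R \<inter> S = {}"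
  shows "\<exists>u q. u \<notin> F \<and> linkage r X Y (insert u F) q"
  using assms
proof (induction "\<Sum>s\<in>F. length (p s)" arbitrary: X F p rule: less_induct)
  case less
  note p = less.prems(2)
  have w: "walk_from_to r X Y (p s)" "hd (p s) = s" if "s \<in> F" for s
    using p that by (auto simp: linkage_def)
  have dis: "set (p s) \<inter> set (p t) = {}" if "s \<in> F" "t \<in> F" "s \<noteq> t" for s t
    using p that unfolding linkage_def by blast
  have in_p: "s \<in> set (p s)" if "s \<in> F" for s
    using w[OF that] by (metis hd_in_set walk_from_to_def)
  have FX: "F \<subseteq> X"
    using w by (metis subsetI walk_from_to_def)
  have "F \<subseteq> N" using less.prems(3) in_p by blast
  then obtain R where R: "walk_from_to r X Y R" "set R \<inter> F = {}"
    using less.prems(1,4) by blast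
  show ?case
  proof (cases "\<exists>z\<in>set R. z \<in> (\<Union>s\<in>F. set (p s))")
    case False
    define u where "u = hd R"
    have "u \<notin> F" using R unfolding u_def walk_from_to_def by (metis disjoint_iff hd_in_set)
    moreover have "linkage r X Y (insert u F) (p(u := R))"
      unfolding linkage_def
    proof (intro conjI ballI impI)
      fix s assume "s \<in> insert u F"
      then show "walk_from_to r X Y ((p(u := R)) s)" "hd ((p(u := R)) s) = s"
        using w R(1) \<open>u \<notin> F\<close> by (auto simp: u_def)
    next
      fix s t assume st: "s \<in> insert u F" "t \<in> insert u F" "s \<noteq> t"
      have R_P: "set R \<inter> set (p s) = {}" if "s \<in> F" for s using False that by auto
      have eq: "(p(u := R)) s = p s" if "s \<in> F" for s using that \<open>u \<notin> F\<close> by auto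
      consider "s = u" "t \<in> F" | "t = u" "s \<in> F" | "s \<in> F" "t \<in> F" using st by blast
      then show "set ((p(u := R)) s) \<inter> set ((p(u := R)) t) = {}"
      proof cases
        case 1
        then show ?thesis using R_P[of t] eq[of t] by simp
      next
        case 2
        then show ?thesis using R_P[of s] eq[of s] by (simp add: Int_commute)
      next
        case 3
        then show ?thesis using dis st(3) eq by simp
      qed
    qed
    ultimately show ?thesis by blast
  next
    case True
    then obtain Ra z Rb where Rz: "R = Ra @ z # Rb" "z \<in> (\<Union>s\<in>F. set (p s))"
      "\<forall>t\<in>set Ra. t \<notin> (\<Union>s\<in>F. set (p s))"
      using split_list_first_prop[of R "\<lambda>z. z \<in> (\<Union>s\<in>F. set (p s))"] by blast
    then obtain s0 where s0: "s0 \<in> F" "z \<in> set (p s0)" by blast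
    obtain Pa Pb where P: "p s0 = Pa @ z # Pb" using s0(2) by (auto simp: in_set_conv_decomp)
    have "z \<notin> F" using R(2) Rz(1) by auto
    then have "Pa \<noteq> []" using w(2)[OF s0(1)] P s0(1) by auto
    then have hdPa: "hd Pa = s0" "s0 \<in> set Pa" using w(2)[OF s0(1)] P by auto
    have dist: "distinct (Pa @ z # Pb)" using less.prems(3) s0(1) P by metis
    define G where "G = F - {s0}"
    have F: "F = insert s0 G" "s0 \<notin> G" using s0 by (auto simp: G_def)
    have "finite G" using less.prems(1) by (simp add: G_def)
    have zG: "z \<notin> G" using \<open>z \<notin> F\<close> F by auto
    define X' where "X' = X \<union> set Pa \<union> set Ra \<union> {z}"
    define p' where "p' = p(z := z # Pb)"
    have p': "p' z = z # Pb" "\<And>s. s \<in> G \<Longrightarrow> p' s = p s" using zG by (auto simp: p'_def)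
    have Ra_P: "set Ra \<inter> set (p s) = {}" if "s \<in> F" for s using Rz(3) that by blast
    have G_P: "set (p s) \<inter> set (Pa @ z # Pb) = {}" "set (p s) \<inter> set Ra = {}" if "s \<in> G" for s
      using dis[of s s0] s0(1) P that F Ra_P[of s] by auto
    have PaX: "set (tl Pa @ z # Pb) \<inter> X = {}"
      using w(1)[OF s0(1)] P \<open>Pa \<noteq> []\<close> by (simp add: walk_from_to_def)
    have "successively r (Pa @ z # Pb)" "last (z # Pb) \<in> Y"
      using w(1)[OF s0(1)] P by (auto simp: walk_from_to_def)
    then have sPa: "successively r (Pa @ [z])" "successively r (z # Pb)"
      by (auto simp: successively_append_iff)
    have "set (tl (Ra @ [z])) \<subseteq> set (tl R)" unfolding Rz(1) by (cases Ra) auto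
    moreover have "hd (Ra @ [z]) = hd R" unfolding Rz(1) by (cases Ra) auto
    moreover have "R = (Ra @ [z]) @ Rb" using Rz(1) by simp
    then have "successively r ((Ra @ [z]) @ Rb)" using R(1) unfolding walk_from_to_def by metis
    then have "successively r (Ra @ [z])" unfolding successively_append_iff[of r "Ra @ [z]"] by blast
    ultimately have RaX: "set (tl (Ra @ [z])) \<inter> X = {}" "successively r (Ra @ [z])"
      "hd (Ra @ [z]) \<in> X"
      using R(1) by (auto simp: walk_from_to_def)
    have hdRa: "hd (Ra @ [z]) \<notin> F" using R(2) Rz(1) by (cases Ra) auto
    have RaPa: "set Ra \<inter> set Pa = {}" "z \<notin> set Ra"
      using Ra_P[OF s0(1)] P by auto
    have link': "linkage r X' Y (insert z G) p'"
      unfolding linkage_def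
    proof (intro conjI ballI impI)
      fix s assume s: "s \<in> insert z G"
      show "hd (p' s) = s" using s p' w(2) F by auto
      show "walk_from_to r X' Y (p' s)"
      proof (cases "s = z")
        case True
        have "set Pb \<inter> X' = {}"
          using PaX dist Ra_P[OF s0(1)] P by (auto simp: X'_def)
        then show ?thesis
          using True p' \<open>last (z # Pb) \<in> Y\<close> sPa by (simp add: walk_from_to_def X'_def)
      next
        case False
        then have "s \<in> G" using s by simp
        have "set (tl (p s)) \<subseteq> set (p s)" by (cases "p s") auto
        then have "set (tl (p s)) \<inter> X' = {}"
          using w(1)[of s] G_P[OF \<open>s \<in> G\<close>] \<open>s \<in> G\<close> F by (auto simp: X'_def walk_from_to_def)
        then show ?thesis
          using w(1)[of s] \<open>s \<in> G\<close> F p'(2) by (auto simp: X'_def walk_from_to_def)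
      qed
    next
      fix s t assume st: "s \<in> insert z G" "t \<in> insert z G" "s \<noteq> t"
      show "set (p' s) \<inter> set (p' t) = {}"
      proof -
        have z_G: "set (z # Pb) \<inter> set (p t) = {}" if "t \<in> G" for t
          using G_P(1)[OF that] by auto
        consider "s = z" "t \<in> G" | "t = z" "s \<in> G" | "s \<in> G" "t \<in> G" using st by blast
        then show ?thesis
        proof cases
          case 1
          then show ?thesis using z_G[of t] p' by simp
        next
          case 2
          then show ?thesis using z_G[of s] p' by (simp add: Int_commute)
        next
          case 3
          then show ?thesis using dis[of s t] st(3) p' F by simp
        qed
      qed
    qed
    have measure: "(\<Sum>s\<in>insert z G. length (p' s)) < (\<Sum>s\<in>F. length (p s))"
    proof -
      have "(\<Sum>s\<in>G. length (p' s)) = (\<Sum>s\<in>G. length (p s))"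
        by (rule sum.cong) (simp_all add: p'(2))
      then show ?thesis
        using \<open>finite G\<close> zG F(2) p'(1) P \<open>Pa \<noteq> []\<close> unfolding F(1) by simp
    qed
    have "card (insert z G) = card F" using \<open>finite G\<close> zG F by simp
    have "\<exists>u q. u \<notin> insert z G \<and> linkage r X' Y (insert u (insert z G)) q"
    proof (rule less.hyps[OF measure _ link'])
      show "finite (insert z G)" using \<open>finite G\<close> by simp
      show "\<forall>s\<in>insert z G. distinct (p' s) \<and> set (p' s) \<subseteq> N"
        using less.prems(3) p' F dist P by auto
      fix S assume S: "S \<subseteq> N" "finite S" "card S = card (insert z G)"
      then obtain Q where Q: "walk_from_to r X Y Q" "set Q \<inter> S = {}"
        using less.prems(4) \<open>card (insert z G) = card F\<close> by metis
      \<comment> \<open>\<open>Q\<close> starts in \<open>X\<close> and hence in \<open>X'\<close>;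
        its part from the last visit to \<open>X'\<close> onwards is the required walk.\<close>
      then obtain Q' where "walk_from_to r X' Y Q'" "set Q' \<subseteq> set Q"
        using walk_from_to_trim[of Q X' Y r] by (auto simp: walk_from_to_def X'_def)
      then show "\<exists>R. walk_from_to r X' Y R \<and> set R \<inter> S = {}" using Q(2) by blast
    qed
    then obtain u q where u: "u \<notin> insert z G" and q: "linkage r X' Y (insert u (insert z G)) q"
      by blast
    have "u \<in> X'" using q by (auto simp: linkage_def walk_from_to_def)
    note splice = linkage_splice[OF q, of X]
    have "X \<subseteq> X'" "u \<noteq> z" "u \<notin> G" "G \<subseteq> X" using u FX F by (auto simp: X'_def)
    have notin: "(set Pa \<union> set Ra) \<inter> insert z G = {}"
    proof -
      have "t \<notin> set Pa" "t \<notin> set Ra" if "t \<in> G" for t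
        using G_P[OF that] in_p[of t] F(1) that by auto
      then show ?thesis using dist RaPa by auto
    qed
    \<comment> \<open>The walks starting at \<open>z\<close> and \<open>u\<close> must be led back
      to \<open>X\<close>. If \<open>u\<close> lies on \<open>Pa\<close>, then \<open>u\<close> is
      reached along \<open>Pa\<close> and \<open>z\<close> along \<open>Ra\<close>. Otherwise
      \<open>z\<close> is reached along \<open>Pa\<close>, and \<open>u\<close> along
      \<open>Ra\<close> or as a source of its own. So \<open>s0\<close> remains a start in every
      case and exactly one new start arises.\<close>
    consider "u \<in> set Pa" | "u \<in> set Ra" | "u \<in> X" "u \<notin> set Pa" "u \<notin> set Ra"
      using \<open>u \<in> X'\<close> u by (auto simp: X'_def)
    then show ?thesis
    proof cases
      case 1
      then obtain Pu Pv where Pu: "Pa = Pu @ u # Pv" by (auto simp: in_set_conv_decomp)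
      have "hd (Pu @ [u]) = s0" using Pu hdPa by (cases Pu) auto
      have "set (tl (Pu @ [u])) \<subseteq> set (tl Pa)" using Pu by (cases Pu) auto
      have "\<exists>p. linkage r X Y (insert (hd (Ra @ [z])) (insert (hd (Pu @ [u])) G)) p"
      proof (rule splice)
        show "successively r (Pu @ [u])" using sPa(1) Pu by (auto simp: successively_append_iff)
        show "hd (Pu @ [u]) \<in> X" using \<open>hd (Pu @ [u]) = s0\<close> s0 FX by auto
        show "set (tl (Pu @ [u])) \<inter> X = {}" using \<open>set (tl (Pu @ [u])) \<subseteq> set (tl Pa)\<close> PaX by auto
        show "set Ra \<union> set Pu \<subseteq> X'" using Pu by (auto simp: X'_def)
        show "set Ra \<inter> set Pu = {}" using RaPa Pu by auto
        show "(set Ra \<union> set Pu) \<inter> insert u (insert z G) = {}"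
          using notin Pu dist RaPa by auto
      qed fact+
      then show ?thesis using hdRa F \<open>hd (Pu @ [u]) = s0\<close> by metis
    next
      case 2
      then obtain Ru Rv where Ru: "Ra = Ru @ u # Rv" "u \<notin> set Ru" by (metis split_list_first)
      have hdRu: "hd (Ru @ [u]) = hd (Ra @ [z])" using Ru by (cases Ru) auto
      have "set (tl (Ru @ [u])) \<subseteq> set (tl (Ra @ [z]))" using Ru by (cases Ru) auto
      have hdPa': "hd (Pa @ [z]) = s0" using hdPa \<open>Pa \<noteq> []\<close> by simp
      have "\<exists>p. linkage r X Y (insert (hd (Pa @ [z])) (insert (hd (Ru @ [u])) G)) p"
      proof (rule splice)
        show "successively r (Ru @ [u])" using RaX(2) Ru by (auto simp: successively_append_iff)
        show "hd (Ru @ [u]) \<in> X" using hdRu RaX by auto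
        show "set (tl (Ru @ [u])) \<inter> X = {}"
          using \<open>set (tl (Ru @ [u])) \<subseteq> set (tl (Ra @ [z]))\<close> RaX(1) by auto
        show "hd (Pa @ [z]) \<in> X" using hdPa' s0 FX by auto
        show "set (tl (Pa @ [z])) \<inter> X = {}" using PaX \<open>Pa \<noteq> []\<close> by auto
        show "set Pa \<union> set Ru \<subseteq> X'" using Ru by (auto simp: X'_def)
        show "set Pa \<inter> set Ru = {}" using RaPa Ru by auto
        show "(set Pa \<union> set Ru) \<inter> insert u (insert z G) = {}"
          using notin Ru dist RaPa by auto
      qed fact+
      then show ?thesis using hdRa F hdRu hdPa' by (metis insert_commute)
    next
      case 3
      have hdPa': "hd (Pa @ [z]) = s0" using hdPa \<open>Pa \<noteq> []\<close> by simp
      have "\<exists>p. linkage r X Y (insert (hd (Pa @ [z])) (insert (hd ([] @ [u])) G)) p"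
      proof (rule splice)
        show "hd (Pa @ [z]) \<in> X" using hdPa' s0 FX by auto
        show "set (tl (Pa @ [z])) \<inter> X = {}" using PaX \<open>Pa \<noteq> []\<close> by auto
        show "set Pa \<union> set [] \<subseteq> X'" by (auto simp: X'_def)
        show "(set Pa \<union> set []) \<inter> insert u (insert z G) = {}" using notin 3 by auto
      qed (use 3(1) \<open>X \<subseteq> X'\<close> \<open>u \<noteq> z\<close> \<open>u \<notin> G\<close> \<open>G \<subseteq> X\<close> zG sPa(1) in simp_all)
      moreover have "u \<notin> F" using F 3 hdPa \<open>u \<notin> G\<close> by auto
      ultimately show ?thesis using F hdPa' by (metis append_Nil insert_commute list.sel(1))
    qed
  qed
qed

section \<open>Bidirected graphs\<close>

definition flip_arc :: "('v, 'e) oriented_edge \<Rightarrow> ('v, 'e) oriented_edge" where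
  "flip_arc a = Oriented (endvertex a) (edge_of a) (startvertex a)"

definition end_sign :: "('v, 'e) bigraph \<Rightarrow> ('v, 'e) oriented_edge \<Rightarrow> sign" where
  "end_sign B a = sgn_at B (endvertex a) (edge_of a)"

lemma flip_arc_sel [simp]:
  "startvertex (flip_arc a) = endvertex a" "endvertex (flip_arc a) = startvertex a"
  "edge_of (flip_arc a) = edge_of a"
  by (simp_all add: flip_arc_def)

lemma oriented_edge_in_flip [simp]: "oriented_edge_in B (flip_arc a) \<longleftrightarrow> oriented_edge_in B a"
  by (auto simp: oriented_edge_in_def)

lemma flip_flip_arc: "flip_arc (flip_arc a) = a"
  by (cases a) (simp add: flip_arc_def)

section \<open>Deleting edges, and why the two alternatives exclude each other\<close>

lemma walk_delete_edges:
  "walk (delete_edges B S) W \<longleftrightarrow> walk B W \<and> walk_edges W \<inter> S = {}"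
proof -
  have "oriented_edge_in (delete_edges B S) a \<longleftrightarrow> oriented_edge_in B a \<and> edge_of a \<notin> S" for a
    by (auto simp: oriented_edge_in_def delete_edges_def)
  moreover have "walk_edges W \<inter> S = {} \<longleftrightarrow> (\<forall>j<length (arcs W). edge_of (arcs W ! j) \<notin> S)"
    unfolding walk_edges_def all_set_conv_all_nth[symmetric, of "arcs W" "\<lambda>a. edge_of a \<notin> S"] by blast
  ultimately show ?thesis
    by (auto simp: walk_def delete_edges_def)
qed

lemma path_between_delete_edges:
  "path_between (delete_edges B S) x y W \<longleftrightarrow> path_between B x y W \<and> walk_edges W \<inter> S = {}"
  by (auto simp: path_between_def path_def walk_delete_edges)

text \<open>Otherwise each of the \<open>n\<close> disjoint paths would contain an element of
  \<open>S\<close> of its own. For \<open>n = k + 1\<close> this rules out that both alternatives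
  hold.\<close>

lemma path_avoiding_few_edges:
  assumes "edge_disjoint_paths B x y n P" "finite S" "card S < n"
  shows "\<exists>Q. path_between (delete_edges B S) x y Q"
proof (rule ccontr)
  assume no: "\<nexists>Q. path_between (delete_edges B S) x y Q"
  have "\<exists>f. f \<in> walk_edges (P i) \<inter> S" if "i \<in> {1..n}" for i
    using no assms(1) that unfolding path_between_delete_edges edge_disjoint_paths_def by blast
  then obtain f where f: "f i \<in> walk_edges (P i) \<inter> S" if "i \<in> {1..n}" for i
    by metis
  have "inj_on f {1..n}"
  proof (rule inj_onI, rule ccontr)
    fix i j assume "i \<in> {1..n}" "j \<in> {1..n}" "f i = f j" "i \<noteq> j"
    moreover from this have "edge_disjoint (P i) (P j)"
      using assms(1) by (simp add: edge_disjoint_paths_def)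
    ultimately show False using f[of i] f[of j] by (auto simp: edge_disjoint_def)
  qed
  moreover have "f ` {1..n} \<subseteq> S" using f by blast
  ultimately show False using card_inj_on_le[of f "{1..n}" S] assms(2,3) by simp
qed

locale rooted_bidirected_graph = bidirected_graph B for B :: "('v, 'e) bigraph" +
  fixes x :: 'v
  assumes edge_clean_root: "edge_clean B x"
begin

sublocale signed_arcs flip_arc endvertex "end_sign B"
  by unfold_locales (rule flip_flip_arc)

lemma follows_iff:
  "follows a b \<longleftrightarrow> endvertex a = startvertex b \<and>
     sgn_at B (endvertex a) (edge_of a) \<noteq> sgn_at B (startvertex b) (edge_of b)"
  by (simp add: follows_def end_sign_def)

definition graph_edges :: "('v, 'e) oriented_edge set set" where
  "graph_edges = ed ` Collect (oriented_edge_in B)"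

lemma ed_in_graph_edges: "ed a \<in> graph_edges \<longleftrightarrow> oriented_edge_in B a"
  by (simp add: graph_edges_def ed_in_image)

lemma ed_eq_if_edge_of_eq:
  assumes "oriented_edge_in B a" "oriented_edge_in B b" "edge_of a = edge_of b"
  shows "ed a = ed b"
proof -
  have "{startvertex a, endvertex a} = {startvertex b, endvertex b}"
    using assms by (simp add: oriented_edge_in_def)
  then have "a = b \<or> a = flip_arc b"
    using assms(3) by (cases a; cases b) (auto simp: flip_arc_def doubleton_eq_iff)
  then show ?thesis by (simp add: ed_eq_iff)
qed

lemma oriented_edge_verts:
  assumes "oriented_edge_in B a"
  shows "startvertex a \<in> verts B" "endvertex a \<in> verts B"
proof -
  obtain u v where "u \<in> verts B" "v \<in> verts B" "ends B (edge_of a) = {u, v}"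
    using assms ends_edge by (metis oriented_edge_in_def)
  then have "{startvertex a, endvertex a} \<subseteq> verts B"
    using assms by (auto simp: oriented_edge_in_def)
  then show "startvertex a \<in> verts B" "endvertex a \<in> verts B" by auto
qed

lemma walk_iff:
  assumes "l \<noteq> []"
  shows "walk B (Walk vs l) \<longleftrightarrow>
    vs = startvertex (hd l) # map endvertex l \<and> (\<forall>a\<in>set l. oriented_edge_in B a) \<and> successively follows l"
proof
  assume W: "walk B (Walk vs l)"
  then have len: "length vs = Suc (length l)"
    and arc: "\<And>j. j < length l \<Longrightarrow> oriented_edge_in B (l ! j) \<and> startvertex (l ! j) = vs ! j \<and>
      endvertex (l ! j) = vs ! Suc j"
    and sgns: "\<And>j. Suc j < length l \<Longrightarrow> sgn_at B (vs ! Suc j) (edge_of (l ! j)) \<noteq>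
      sgn_at B (vs ! Suc j) (edge_of (l ! Suc j))"
    by (auto simp: walk_def)
  have "vs = startvertex (hd l) # map endvertex l"
  proof (rule nth_equalityI)
    fix i assume "i < length vs"
    then show "vs ! i = (startvertex (hd l) # map endvertex l) ! i"
      using len arc[of 0] arc[of "i - 1"] assms by (cases i) (auto simp: hd_conv_nth)
  qed (use len in simp)
  moreover have "successively follows l"
    unfolding successively_conv_nth follows_iff using arc sgns Suc_lessD by metis
  ultimately show "vs = startvertex (hd l) # map endvertex l \<and>
      (\<forall>a\<in>set l. oriented_edge_in B a) \<and> successively follows l"
    using arc by (metis in_set_conv_nth)
next
  assume R: "vs = startvertex (hd l) # map endvertex l \<and> (\<forall>a\<in>set l. oriented_edge_in B a) \<and>
    successively follows l"
  have "set vs \<subseteq> verts B"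
    using R assms oriented_edge_verts by auto
  moreover have fol: "follows (l ! j) (l ! Suc j)" if "Suc j < length l" for j
    using R that by (simp add: successively_conv_nth)
  moreover have "startvertex (l ! j) = vs ! j" if "j < length l" for j
    using that R assms fol[of "j - 1"] by (cases j) (auto simp: hd_conv_nth follows_iff)
  ultimately show "walk B (Walk vs l)"
    using R unfolding walk_def by (auto simp: follows_iff)
qed

lemma trail_if_trl:
  assumes "trl graph_edges l" "l \<noteq> []"
  shows "trail B (Walk (startvertex (hd l) # map endvertex l) l)"
proof -
  have "\<forall>a\<in>set l. oriented_edge_in B a"
    using assms(1) ed_in_graph_edges by (auto simp: trl_def)
  moreover have "inj_on edge_of (set l)"
  proof (rule inj_onI)
    fix a b assume "a \<in> set l" "b \<in> set l" "edge_of a = edge_of b"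
    moreover from this have "ed a = ed b"
      using ed_eq_if_edge_of_eq \<open>\<forall>a\<in>set l. oriented_edge_in B a\<close> by blast
    ultimately show "a = b" using assms(1) by (auto simp: trl_def distinct_map dest: inj_onD)
  qed
  then have "distinct (map edge_of l)"
    using assms(1) by (auto simp: trl_def distinct_map)
  ultimately show ?thesis
    using assms by (simp add: trail_def walk_iff trl_def)
qed

sublocale clean_root flip_arc endvertex "end_sign B" graph_edges x
proof
  fix b a assume b: "endvertex (flip_arc b) = x" "reach graph_edges b a"
  show "endvertex a \<noteq> x"
  proof
    assume a: "endvertex a = x"
    obtain l where l: "trl graph_edges l" "l \<noteq> []" "hd l = b" "last l = a"
      using b(2) by (auto simp: reach_def)
    have "trail B (Walk (x # map endvertex l) l)" using trail_if_trl[OF l(1,2)] l(3) b(1) by simp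
    moreover have "last (x # map endvertex l) = x" using l(2,4) a by (simp add: last_map)
    moreover define W where "W = Walk (x # map endvertex l) l"
    ultimately have "trail B W \<and> nontrivial W \<and> first_vertex W = x \<and> last_vertex W = x"
      using l(2) by (simp add: nontrivial_def first_vertex_def last_vertex_def Suc_le_eq)
    then show False using edge_clean_root unfolding edge_clean_def by blast
  qed
qed

section \<open>Translating between paths of \<open>B\<close> and walks in the line digraph\<close>

definition nodes :: "('v, 'e) oriented_edge set" where
  "nodes = {a \<in> reachable. \<not> bi a}"

text \<open>All of these are nodes: each is reachable by the trail consisting of itself, and
  cleanness prevents it from being two-way.\<close>

definition root_arcs :: "('v, 'e) oriented_edge set" where
  "root_arcs = {a. oriented_edge_in B a \<and> startvertex a = x}"

definition node_walk :: "'v \<Rightarrow> ('v, 'e) oriented_edge list \<Rightarrow> bool" where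
  "node_walk y = walk_from_to step root_arcs (Collect (final y))"

lemma path_between_iff:
  assumes "l \<noteq> []"
  shows "path_between B x y (Walk vs l) \<longleftrightarrow> vs = x # map endvertex l \<and> startvertex (hd l) = x \<and>
    (\<forall>a\<in>set l. oriented_edge_in B a) \<and> successively follows l \<and> distinct (x # map endvertex l) \<and>
    endvertex (last l) = y"
  using assms
  by (auto simp: path_between_def path_def nontrivial_def first_vertex_def last_vertex_def walk_iff
      last_map Suc_le_eq)

text \<open>The reverse of a node is not reachable, so an edge carries at most one node. Thus a
  separating set of nodes becomes a set of equally many edges.\<close>

lemma nodes_eq_if_edge_of_eq:
  assumes "a \<in> nodes" "b \<in> nodes" "edge_of a = edge_of b"
  shows "a = b"
proof -
  have "oriented_edge_in B a" "oriented_edge_in B b"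
    using assms reachable_ed ed_in_graph_edges by (auto simp: nodes_def)
  then have "ed a = ed b" using assms(3) ed_eq_if_edge_of_eq by blast
  then show ?thesis
    using assms flip_notin_reachable by (auto simp: ed_eq_iff nodes_def)
qed

lemma node_walk_if_path:
  assumes "path_between B x y W"
  defines "ws \<equiv> filter (\<lambda>c. \<not> bi c) (arcs W)"
  shows "node_walk y ws" "hd ws = first_oriented_edge W" "distinct ws" "set ws \<subseteq> nodes"
    "set ws \<subseteq> set (arcs W)"
proof -
  obtain vs l where Wl: "W = Walk vs l" by (cases W)
  have "l \<noteq> []" using assms(1) Wl by (auto simp: path_between_def nontrivial_def)
  then have l: "startvertex (hd l) = x" "\<forall>a\<in>set l. oriented_edge_in B a" "successively follows l"
    "distinct (map endvertex l)" "endvertex (last l) = y"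
    using assms(1) by (simp_all add: Wl path_between_iff)
  have tr: "trl graph_edges l"
    using l distinct_ed_if_distinct_tgt ed_in_graph_edges by (auto simp: trl_def)
  have rch: "set l \<subseteq> reachable"
    using root_reachable[OF tr \<open>l \<noteq> []\<close>] l(1) by auto
  obtain a q where aq: "l = a # q" using \<open>l \<noteq> []\<close> by (cases l) auto
  have a: "\<not> bi a" using bi_not_root[of a] l(1) aq by auto
  have ws: "ws = a # filter (\<lambda>c. \<not> bi c) q" using a aq Wl by (simp add: ws_def)
  \<comment> \<open>The arc before \<open>c\<close> is reachable and hence does not end at
    \<open>x\<close>.\<close>
  have "startvertex c \<noteq> x" if "c \<in> set q" for c
  proof -
    obtain q1 q2 where "q = q1 @ c # q2" using \<open>c \<in> set q\<close> by (auto simp: in_set_conv_decomp)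
    then have "l = (a # q1) @ c # q2" by (simp add: aq)
    moreover from this have "successively follows ((a # q1) @ c # q2)" using l(3) by simp
    then have "follows (last (a # q1)) c"
      unfolding successively_append_iff[of follows "a # q1"] by simp
    ultimately have "follows (last (a # q1)) c" "last (a # q1) \<in> set l" by auto
    then show ?thesis using rch reachable_not_root by (metis follows_iff subsetD)
  qed
  then have "set (tl ws) \<inter> root_arcs = {}" using ws by (auto simp: root_arcs_def)
  moreover have "successively step ws \<and> final y (last ws)"
    using project[of a q y] l rch a unfolding ws_def by (simp add: aq Wl)
  ultimately show "node_walk y ws"
    using ws l aq by (auto simp: node_walk_def walk_from_to_def root_arcs_def)
  show "hd ws = first_oriented_edge W" using ws aq Wl by (simp add: first_oriented_edge_def)
  have "distinct l" using l(4) by (simp add: distinct_map)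
  then show "distinct ws" using Wl by (simp add: ws_def)
  show "set ws \<subseteq> nodes" "set ws \<subseteq> set (arcs W)" using rch Wl by (auto simp: ws_def nodes_def)
qed

lemma node_walk_nodes:
  assumes "node_walk y ws"
  shows "set ws \<subseteq> nodes"
  using walk_nonbi[of ws y] assms by (auto simp: node_walk_def walk_from_to_def nodes_def)

lemma path_if_node_walk:
  assumes "node_walk y ws"
  obtains W where "path_between B x y W" "first_oriented_edge W = hd ws"
    "\<forall>c\<in>set (arcs W). c \<in> reachable \<and> (c \<in> set ws \<or> (\<exists>a\<in>set ws. enters a c))"
proof -
  have ws: "successively step ws" "ws \<noteq> []" "final y (last ws)" "hd ws \<in> root_arcs"
    using assms by (auto simp: node_walk_def walk_from_to_def)
  obtain p where p: "p \<noteq> []" "hd p = hd ws" "successively follows p" "distinct (map endvertex p)"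
    "set p \<subseteq> reachable" "endvertex (last p) = y"
    "\<forall>c\<in>set p. c \<in> set ws \<or> (\<exists>a\<in>set ws. enters a c)"
    using lift[OF ws(1-3)] by blast
  have "x \<notin> endvertex ` set p" using p(5) reachable_not_root by blast
  moreover have "\<forall>a\<in>set p. oriented_edge_in B a"
    using p(5) reachable_ed ed_in_graph_edges by blast
  ultimately have "path_between B x y (Walk (x # map endvertex p) p)"
    using p(1-4,6) ws(4) by (simp add: path_between_iff root_arcs_def)
  then show thesis
    by (rule that) (use p in \<open>auto simp: first_oriented_edge_def\<close>)
qed

text \<open>A common edge is either a node of both walks, or two-way and entered from both. In the
  second case the entries coincide by \<open>enters_unique_ed\<close>, so again the walks share a
  node.\<close>

lemma edge_disjoint_if_node_disjoint:
  assumes "set ws \<subseteq> nodes" "set ws' \<subseteq> nodes" "set ws \<inter> set ws' = {}"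
    "\<forall>c\<in>set (arcs W). c \<in> reachable \<and> (c \<in> set ws \<or> (\<exists>a\<in>set ws. enters a c))"
    "\<forall>c\<in>set (arcs W'). c \<in> reachable \<and> (c \<in> set ws' \<or> (\<exists>a\<in>set ws'. enters a c))"
  shows "edge_disjoint W W'"
proof (rule ccontr)
  assume "\<not> edge_disjoint W W'"
  then obtain c d where cd: "c \<in> set (arcs W)" "d \<in> set (arcs W')" "edge_of c = edge_of d"
    by (auto simp: edge_disjoint_def walk_edges_def)
  then have "oriented_edge_in B c" "oriented_edge_in B d"
    using assms(4,5) reachable_ed ed_in_graph_edges by blast+
  then have ed: "ed c = ed d" using ed_eq_if_edge_of_eq cd(3) by blast
  have nonbi: "\<not> bi a" if "a \<in> set ws \<union> set ws'" for a using assms(1,2) that by (auto simp: nodes_def)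
  consider "c \<in> set ws" "d \<in> set ws'" | a where "enters a c" "d \<in> set ws'"
    | a where "c \<in> set ws" "enters a d"
    | a b where "a \<in> set ws" "b \<in> set ws'" "enters a c" "enters b d"
    using assms(4,5) cd(1,2) by blast
  then show False
  proof cases
    case 1
    then have "c = d" using nodes_eq_if_edge_of_eq assms(1,2) cd(3) by blast
    then show False using 1 assms(3) by blast
  next
    case 2
    then show False using ed_neq_bi[of d c] enters_bi nonbi ed by auto
  next
    case 3
    then show False using ed_neq_bi[of c d] enters_bi nonbi ed by auto
  next
    case 4
    then show False using enters_unique_ed[OF 4(3,4) ed] assms(3) by blast
  qed
qed

text \<open>If some \<open>k\<close> nodes meet all node walks, their edges form the cut, because
  every path projects to a node walk on its own arcs. If no such set exists, this is the remaining
  hypothesis of \<open>linkage_augment\<close>.\<close>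

lemma cut_or_augment:
  assumes P: "edge_disjoint_paths B x y k P" and e: "\<forall>i\<in>{1..k}. e i = first_oriented_edge (P i)"
  shows "(\<exists>S. S \<subseteq> edges B \<and> finite S \<and> card S = k \<and> \<not> (\<exists>Q. path_between (delete_edges B S) x y Q)) \<or>
    (\<exists>P'. edge_disjoint_paths B x y (k + 1) P' \<and> (\<forall>i\<in>{1..k}. first_oriented_edge (P' i) = e i))"
proof (cases "\<exists>S. S \<subseteq> nodes \<and> finite S \<and> card S = k \<and> (\<forall>R. node_walk y R \<longrightarrow> set R \<inter> S \<noteq> {})")
  case True
  then obtain S where S: "S \<subseteq> nodes" "finite S" "card S = k" "\<And>R. node_walk y R \<Longrightarrow> set R \<inter> S \<noteq> {}"
    by blast
  have "inj_on edge_of S" using S(1) nodes_eq_if_edge_of_eq by (meson inj_onI subsetD)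
  then have "card (edge_of ` S) = k" using S(3) by (simp add: card_image)
  moreover have "edge_of ` S \<subseteq> edges B"
    using S(1) reachable_ed ed_in_graph_edges by (auto simp: nodes_def oriented_edge_in_def)
  moreover have "\<not> path_between (delete_edges B (edge_of ` S)) x y Q" for Q
  proof
    assume "path_between (delete_edges B (edge_of ` S)) x y Q"
    then have Q: "path_between B x y Q" "walk_edges Q \<inter> edge_of ` S = {}"
      by (auto simp: path_between_delete_edges)
    then show False
      using S(4)[OF node_walk_if_path(1)[OF Q(1)]] by (auto simp: walk_edges_def)
  qed
  ultimately show ?thesis using S(2) by blast
next
  case False
  define p where "p i = filter (\<lambda>c. \<not> bi c) (arcs (P i))" for i
  have path: "path_between B x y (P i)" if "i \<in> {1..k}" for i
    using P that by (simp add: edge_disjoint_paths_def)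
  have p: "node_walk y (p i)" "hd (p i) = e i" "distinct (p i)" "set (p i) \<subseteq> nodes"
    if "i \<in> {1..k}" for i
    using node_walk_if_path[OF path[OF that]] e that by (simp_all add: p_def)
  have dis: "set (p i) \<inter> set (p j) = {}" if "i \<in> {1..k}" "j \<in> {1..k}" "i \<noteq> j" for i j
  proof -
    have "edge_disjoint (P i) (P j)" using P that by (simp add: edge_disjoint_paths_def)
    then show ?thesis by (auto simp: edge_disjoint_def walk_edges_def p_def)
  qed
  have e_p: "e i \<in> set (p i)" if "i \<in> {1..k}" for i
    using p(1,2)[OF that] by (metis hd_in_set node_walk_def walk_from_to_def)
  have inj: "inj_on e {1..k}" using dis e_p by (intro inj_onI) (metis disjoint_iff)
  define F where "F = e ` {1..k}"
  have F: "finite F" "card F = k" using inj by (auto simp: F_def card_image)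
  \<comment> \<open>The paths are numbered while a linkage is indexed by first arcs;
    \<open>i\<close> translates back and exists because disjoint paths have distinct first
    arcs.\<close>
  define i where "i = inv_into {1..k} e"
  have i: "i s \<in> {1..k}" "e (i s) = s" if "s \<in> F" for s
    using that unfolding F_def i_def by (simp_all only: inv_into_into f_inv_into_f)
  have "\<exists>u q. u \<notin> F \<and> linkage step root_arcs (Collect (final y)) (insert u F) q"
  proof (rule linkage_augment[OF F(1), of _ _ _ "\<lambda>s. p (i s)" nodes])
    show "linkage step root_arcs (Collect (final y)) F (\<lambda>s. p (i s))"
      unfolding linkage_def
    proof (intro conjI ballI impI)
      fix s assume "s \<in> F"
      then show "walk_from_to step root_arcs (Collect (final y)) (p (i s))" "hd (p (i s)) = s"
        using p(1,2)[OF i(1)] i(2) by (auto simp: node_walk_def)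
    next
      fix s t assume st: "s \<in> F" "t \<in> F" "s \<noteq> t"
      then have "i s \<noteq> i t" using i(2) by metis
      then show "set (p (i s)) \<inter> set (p (i t)) = {}" using dis i(1) st by blast
    qed
    show "\<forall>s\<in>F. distinct (p (i s)) \<and> set (p (i s)) \<subseteq> nodes" using p(3,4) i(1) by blast
    show "\<exists>R. walk_from_to step root_arcs (Collect (final y)) R \<and> set R \<inter> S = {}"
      if "S \<subseteq> nodes" "finite S" "card S = card F" for S
      using False that F(2) unfolding node_walk_def by blast
  qed
  then obtain u q where u: "u \<notin> F" and q: "linkage step root_arcs (Collect (final y)) (insert u F) q"
    by blast
  have qs: "node_walk y (q s)" "hd (q s) = s" if "s \<in> insert u F" for s
    using q that unfolding linkage_def node_walk_def by blast+
  have "\<exists>W. path_between B x y W \<and> first_oriented_edge W = s \<and>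
      (\<forall>c\<in>set (arcs W). c \<in> reachable \<and> (c \<in> set (q s) \<or> (\<exists>a\<in>set (q s). enters a c)))"
    if "s \<in> insert u F" for s
    using path_if_node_walk[OF qs(1)[OF that]] qs(2)[OF that] by metis
  then obtain W where W: "\<And>s. s \<in> insert u F \<Longrightarrow> path_between B x y (W s)"
    "\<And>s. s \<in> insert u F \<Longrightarrow> first_oriented_edge (W s) = s"
    "\<And>s. s \<in> insert u F \<Longrightarrow>
      \<forall>c\<in>set (arcs (W s)). c \<in> reachable \<and> (c \<in> set (q s) \<or> (\<exists>a\<in>set (q s). enters a c))"
    by metis
  \<comment> \<open>The old first arcs keep their numbers, and the new one \<open>u\<close> receives
    the number \<open>k + 1\<close>.\<close>
  define s where "s j = (if j \<le> k then e j else u)" for j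
  have s_in: "s j \<in> insert u F" if "j \<in> {1..k + 1}" for j
    using that by (auto simp: s_def F_def)
  have s_neq: "s j \<noteq> s j'" if j: "j \<in> {1..k + 1}" "j' \<in> {1..k + 1}" "j \<noteq> j'" for j j'
  proof (cases "j \<le> k \<and> j' \<le> k")
    case True
    then show ?thesis using j inj by (auto simp: s_def dest: inj_onD)
  next
    case False
    then show ?thesis using j u by (auto simp: s_def F_def)
  qed
  have "edge_disjoint_paths B x y (k + 1) (\<lambda>j. W (s j))"
    unfolding edge_disjoint_paths_def
  proof (intro conjI ballI impI)
    fix j assume "j \<in> {1..k + 1}"
    then show "path_between B x y (W (s j))" using W(1) s_in by blast
  next
    fix j j' assume j: "j \<in> {1..k + 1}" "j' \<in> {1..k + 1}" "j \<noteq> j'"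
    have "set (q (s j)) \<inter> set (q (s j')) = {}"
      using q s_in[OF j(1)] s_in[OF j(2)] s_neq[OF j] unfolding linkage_def by blast
    then show "edge_disjoint (W (s j)) (W (s j'))"
      using node_walk_nodes[OF qs(1)] s_in j(1,2) W(3)
      by (intro edge_disjoint_if_node_disjoint[of "q (s j)" "q (s j')"]) blast+
  qed
  moreover have "first_oriented_edge (W (s j)) = e j" if "j \<in> {1..k}" for j
    using W(2)[OF s_in[of j]] that by (simp add: s_def)
  ultimately show ?thesis by blast
qed

end

theorem theorem5p1:
  fixes B :: "('v, 'e) bigraph"
    and x y :: 'v
    and k :: nat
    and P :: "nat \<Rightarrow> ('v, 'e) walk_seq"
    and e :: "nat \<Rightarrow> ('v, 'e) oriented_edge"
  assumes "bidirected_graph B"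
    and "x \<in> verts B" and "y \<in> verts B" and "x \<noteq> y"
    and "edge_clean B x"
    and "edge_disjoint_paths B x y k P"
    and "\<forall>i\<in>{1..k}. e i = first_oriented_edge (P i)"
  shows "((\<exists>S. S \<subseteq> edges B \<and> finite S \<and> card S = k \<and>
             \<not> (\<exists>Q. path_between (delete_edges B S) x y Q))
          \<and> \<not> (\<exists>P'. edge_disjoint_paths B x y (k + 1) P' \<and>
                   (\<forall>i\<in>{1..k}. first_oriented_edge (P' i) = e i)))
       \<or> (\<not> (\<exists>S. S \<subseteq> edges B \<and> finite S \<and> card S = k \<and>
             \<not> (\<exists>Q. path_between (delete_edges B S) x y Q))
          \<and> (\<exists>P'. edge_disjoint_paths B x y (k + 1) P' \<and>
                   (\<forall>i\<in>{1..k}. first_oriented_edge (P' i) = e i)))"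
proof -
  interpret rooted_bidirected_graph B x
    using assms(1,5) by (simp add: rooted_bidirected_graph_def rooted_bidirected_graph_axioms_def)
  have "\<exists>Q. path_between (delete_edges B S) x y Q"
    if "edge_disjoint_paths B x y (k + 1) P'" "finite S" "card S = k" for S P'
    using path_avoiding_few_edges that by (metis less_add_one)
  then show ?thesis using cut_or_augment[OF assms(6,7)] by blast
qed

end
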